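(* Let $G$ be a triangle-free graph on $n$ vertices with $\mu_2(G)\geq \frac{n}{3}$. Then $G$ is bipartite. Moreover, the constant $\frac13$ is asymptotically best possible: for every $\varepsilon>0$ there exist non-bipartite triangle-free graphs $G$ with arbitrarily large number of vertices $n$ such that $\mu_2(G)>\left(\frac13-\varepsilon\right)n$.
   Context: All graphs are finite and simple, with at least two vertices. For a graph $G$ on $n$ vertices, with adjacency matrix $A(G)$ and diagonal degree matrix $D(G)$, the Laplacian matrix is $L(G)=D(G)-A(G)$; its eigenvalues (with multiplicity) are listed as $0=\mu_1(G)\le\mu_2(G)\le\cdots\le\mu_n(G)$, and $\mu_2(G)$ is called the algebraic connectivity of $G$. *)

theory Defs
  imports
    "Graph_Theory.Pair_Digraph"
    "Jordan_Normal_Form.Char_Poly"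
begin

text \<open>
  A finite simple graph is a \<open>pair_graph\<close>: a finite vertex set together with a symmetric and
  irreflexive set of arcs, so the edge \<open>uv\<close> is the pair of arcs \<open>(u, v)\<close>, \<open>(v, u)\<close>, and the degree
  of \<open>v\<close> is its out-degree.
\<close>

definition triangle_free :: "'a pair_pre_digraph \<Rightarrow> bool" where
  "triangle_free G \<longleftrightarrow>
     \<not> (\<exists>x y z. (x, y) \<in> parcs G \<and> (y, z) \<in> parcs G \<and> (x, z) \<in> parcs G)"

definition bipartite :: "'a pair_pre_digraph \<Rightarrow> bool" where
  "bipartite G \<longleftrightarrow>
     (\<exists>X Y. X \<union> Y = pverts G \<and> X \<inter> Y = {} \<and>
        (\<forall>(u, v) \<in> parcs G. (u \<in> X \<and> v \<in> Y) \<or> (u \<in> Y \<and> v \<in> X)))"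

definition adjacency_mat :: "'a list \<Rightarrow> 'a pair_pre_digraph \<Rightarrow> real mat" where
  "adjacency_mat vs G =
     mat (length vs) (length vs) (\<lambda>(i, j). if (vs ! i, vs ! j) \<in> parcs G then 1 else 0)"

definition degree_mat :: "'a list \<Rightarrow> 'a pair_pre_digraph \<Rightarrow> real mat" where
  "degree_mat vs G =
     mat (length vs) (length vs)
       (\<lambda>(i, j). if i = j then real (out_degree (with_proj G) (vs ! i)) else 0)"

definition laplacian_mat :: "'a list \<Rightarrow> 'a pair_pre_digraph \<Rightarrow> real mat" where
  "laplacian_mat vs G = degree_mat vs G - adjacency_mat vs G"

text \<open>
  A matrix needs its rows indexed by \<open>0, \<dots>, n - 1\<close>, hence an enumeration of the vertices. The
  characteristic polynomial does not depend on it, see \<open>char_poly_laplacian_mat_enum\<close> below.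
\<close>

definition vertex_enum :: "'a pair_pre_digraph \<Rightarrow> 'a list" where
  "vertex_enum G = (SOME vs. distinct vs \<and> set vs = pverts G)"

text \<open>
  The eigenvalues in nondecreasing order, each repeated according to its multiplicity as a root of
  the characteristic polynomial. The Laplacian matrix is real symmetric, so this is also the
  dimension of the eigenspace, and no eigenvalue is lost by taking real roots only.
\<close>

definition laplacian_spectrum :: "'a pair_pre_digraph \<Rightarrow> real list" where
  "laplacian_spectrum G =
     sorted_list_of_multiset (proots (char_poly (laplacian_mat (vertex_enum G) G)))"

text \<open>Eigenvalues are numbered from 1, list positions from 0.\<close>

definition laplacian_eigenvalue :: "nat \<Rightarrow> 'a pair_pre_digraph \<Rightarrow> real" (\<open>\<mu>\<^bsub>_\<^esub>\<close>) where
  "\<mu>\<^bsub>k\<^esub> G = laplacian_spectrum G ! (k - 1)"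

lemma vertex_enum:
  assumes "finite (pverts G)"
  shows "distinct (vertex_enum G)" "set (vertex_enum G) = pverts G"
proof -
  have "\<exists>vs. distinct vs \<and> set vs = pverts G"
    using finite_distinct_list[OF assms] by blast
  from someI_ex[OF this]
  show "distinct (vertex_enum G)" "set (vertex_enum G) = pverts G"
    by (simp_all add: vertex_enum_def)
qed

lemma char_poly_laplacian_mat_enum:
  assumes "distinct vs" "distinct ws" "set vs = set ws"
  shows "char_poly (laplacian_mat vs G) = char_poly (laplacian_mat ws G)"
proof -
  define n where "n = length vs"
  have "mset ws = mset vs" using assms set_eq_iff_mset_eq_distinct by blast
  then obtain p where p: "p permutes {..<length vs}" "permute_list p vs = ws"
    by (rule mset_eq_permutation)
  have lw: "length ws = n" using p n_def by auto
  have p0: "p permutes {0..<n}" using p(1) by (simp add: n_def atLeast0LessThan)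
  have pl: "p i < n" if "i < n" for i
    using permutes_in_image[OF p0, of i] that by simp
  have ws: "ws ! i = vs ! p i" if "i < n" for i
    using p that by (auto simp: n_def permute_list_nth)
  have pinj: "p i = p j \<longleftrightarrow> i = j" for i j
    using permutes_inj[OF p0] by (auto dest: injD)
  let ?A = "char_poly_matrix (laplacian_mat vs G)"
  let ?B = "char_poly_matrix (laplacian_mat ws G)"
  define C where "C = mat n n (\<lambda>(i, j). ?A $$ (p i, j))"
  have A: "?A \<in> carrier_mat n n"
    by (rule carrier_matI)
      (simp_all add: char_poly_matrix_def laplacian_mat_def degree_mat_def adjacency_mat_def n_def)
  have C: "C \<in> carrier_mat n n" by (simp add: C_def)
  have detC: "det C = signof p * det ?A"
    unfolding C_def by (rule det_permute_rows[OF A p0])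
  have BC: "transpose_mat ?B = mat n n (\<lambda>(i, j). transpose_mat C $$ (p i, j))"
    by (rule eq_matI)
      (auto simp: C_def char_poly_matrix_def laplacian_mat_def degree_mat_def
        adjacency_mat_def lw ws pl pinj n_def[symmetric])
  have B: "?B \<in> carrier_mat n n"
    by (rule carrier_matI)
      (simp_all add: char_poly_matrix_def laplacian_mat_def degree_mat_def adjacency_mat_def lw)
  have "det ?B = det (transpose_mat ?B)" using det_transpose[OF B] by simp
  also have "\<dots> = signof p * det (transpose_mat C)"
    unfolding BC by (rule det_permute_rows[OF _ p0]) (use C in simp)
  also have "\<dots> = signof p * (signof p * det ?A)"
    using det_transpose[OF C] detC by simp
  also have "\<dots> = det ?A" by (auto simp: sign_def)
  finally show ?thesis by (simp add: char_poly_def)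
qed

end

theory Submission
  imports Defs "Jordan_Normal_Form.Schur_Decomposition"
begin

text \<open>
  If \<open>\<mu>\<^sub>2 \<ge> n/3\<close>, then \<open>\<Sum>\<^sub>v (d(v) - n/3) x(v)\<^sup>2 + (\<Sum>\<^sub>v x(v))\<^sup>2/3 - \<Sum>\<^sub>u\<^sub>v x(u) x(v)\<close>, summed over
  arcs \<open>uv\<close>, is nonnegative for every real \<open>x\<close>. In particular all degrees are at least \<open>n/3\<close>. Call
  independent sets \<open>I\<close>, \<open>J\<close> with at least \<open>n/3\<close> elements each a good pair if they meet and
  \<open>I \<union> J\<close> is not independent. If there is no good pair, then the neighbourhoods of the vertices lie
  in one of two disjoint maximal independent sets, and this is a bipartition. Otherwise take a good
  pair with \<open>|I| + |J|\<close> maximal and put \<open>T = I \<inter> J\<close>, \<open>S\<^sub>1 = I - J\<close>, \<open>S\<^sub>2 = J - I\<close> and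
  \<open>Z = V - (I \<union> J)\<close>. By maximality the bipartite graph between \<open>S\<^sub>1\<close> and \<open>S\<^sub>2\<close> has the normalized
  matching property. Adjacent vertices have disjoint neighbourhoods in \<open>Z\<close>, so the average numbers of
  neighbours in \<open>Z\<close> over \<open>S\<^sub>1\<close> and over \<open>S\<^sub>2\<close> add up to at most \<open>|Z|\<close>. Testing the form with the
  vector that is \<open>-1/(2|T|)\<close> on \<open>T\<close>, \<open>1/|S\<^sub>1|\<close> on \<open>S\<^sub>1\<close>, \<open>1/|S\<^sub>2|\<close> on \<open>S\<^sub>2\<close> and 0 on \<open>Z\<close> then forces
  \<open>|I| = |J| = n/3\<close> and \<open>N(y) = Z\<close> for some \<open>y \<in> T\<close>, and \<open>Z\<close> together with the neighbourhood
  of a vertex of \<open>S\<^sub>1 \<union> S\<^sub>2\<close> contradicts maximality.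

  For the second part, blow up a pentagon with class sizes \<open>1, 1, m, m, m\<close>. Up to an error of order
  \<open>\<epsilon>m + 1/\<epsilon>\<close> its Laplacian form is that of \<open>K\<^sub>m\<^sub>,\<^sub>2\<^sub>m\<close>, plus \<open>m x(v)\<^sup>2\<close> for each of the two
  singleton classes.
\<close>

section \<open>The spectrum of a real symmetric matrix\<close>

text \<open>Gram-Schmidt on a basis that starts with \<open>v\<close> keeps its first vector, so
  after normalization the first column is still a multiple of \<open>v\<close>.\<close>

lemma orthonormal_extension:
  fixes v :: "real vec"
  assumes v: "v \<in> carrier_vec n" "v \<noteq> 0\<^sub>v n"
  obtains W k where "W \<in> carrier_mat n n" "W\<^sup>T * W = 1\<^sub>m n" "col W 0 = k \<cdot>\<^sub>v v"
proof -
  have n: "n > 0" using v by (cases n) auto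
  interpret cof_vec_space n "TYPE(real)" .
  define b where "b = basis_completion v"
  define ws where "ws = gram_schmidt n b"
  from basis_completion[OF v, folded b_def]
  have dist: "distinct b" and indep: "\<not> lin_dep (set b)" and b: "set b \<subseteq> carrier_vec n"
    and hd: "hd b = v" and len: "length b = n" by auto
  from gram_schmidt_result[OF b dist indep refl, folded ws_def]
  have ws: "set ws \<subseteq> carrier_vec n" "corthogonal ws" "length ws = n" by (auto simp: len)
  obtain vs where "b = v # vs" using hd len n by (cases b) auto
  then have "hd ws = v" using gram_schmidt_hd[OF v(1), of vs] by (simp add: ws_def)
  then have ws0: "ws ! 0 = v" using ws(3) n by (cases ws) auto
  define c where "c i = 1 / sqrt (ws ! i \<bullet> ws ! i)" for i
  define us where "us = map (\<lambda>i. c i \<cdot>\<^sub>v ws ! i) [0..<n]"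
  have wsi: "ws ! i \<in> carrier_vec n" if "i < n" for i using ws that by auto
  \<comment> \<open>Conjugation is trivial over the reals. The equivalence also says that no
    \<open>ws ! i\<close> has norm 0, so that \<open>c\<close> normalizes.\<close>
  have orth: "ws ! i \<bullet> ws ! j = 0 \<longleftrightarrow> i \<noteq> j" if "i < n" "j < n" for i j
    using corthogonalD[OF ws(2), of i j] that ws(3) by (simp add: conjugate_vec_def vec_eq_iff)
  have us: "us ! i = c i \<cdot>\<^sub>v ws ! i" "us ! i \<in> carrier_vec n" if "i < n" for i
    using that wsi by (simp_all add: us_def)
  have usu: "us ! i \<bullet> us ! j = (if i = j then 1 else 0)" if "i < n" "j < n" for i j
  proof -
    have "us ! i \<bullet> us ! j = c i * c j * (ws ! i \<bullet> ws ! j)"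
      unfolding us(1)[OF that(1)] us(1)[OF that(2)]
      using smult_scalar_prod_distrib[OF wsi[OF that(1)], of "c j \<cdot>\<^sub>v ws ! j" "c i"]
        scalar_prod_smult_distrib[OF wsi[OF that(1)] wsi[OF that(2)], of "c j"] wsi[OF that(2)]
      by simp
    moreover have "ws ! i \<bullet> ws ! i > 0"
    proof -
      have "ws ! i \<bullet> ws ! i \<ge> 0" by (simp add: scalar_prod_def sum_nonneg)
      then show ?thesis using orth[of i i] that by simp
    qed
    ultimately show ?thesis using orth[OF that] by (auto simp: c_def)
  qed
  define W where "W = mat_of_cols n us"
  have W: "W \<in> carrier_mat n n" using mat_of_cols_carrier(1)[of n us] by (simp add: W_def us_def)
  have colW: "col W i = us ! i" if "i < n" for i
    using that us(2) by (simp add: W_def us_def)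
  have "W\<^sup>T * W = 1\<^sub>m n"
    using W by (intro eq_matI) (auto simp: colW usu)
  moreover have "col W 0 = c 0 \<cdot>\<^sub>v v" using n by (simp add: colW us ws0)
  ultimately show thesis using that W by blast
qed

text \<open>The characteristic polynomial has a complex root \<open>a\<close>, with an eigenvector
  \<open>v\<close>. Then \<open>a\<close> times the squared norm of \<open>v\<close> is the
  Hermitian form of \<open>A\<close> at \<open>v\<close>, which is real by symmetry; hence
  \<open>a\<close> is real.\<close>

lemma symmetric_real_eigenvalue:
  fixes A :: "real mat"
  assumes A: "A \<in> carrier_mat n n" and sym: "A\<^sup>T = A" and n: "n > 0"
  obtains e where "eigenvalue A e"
proof -
  let ?C = "map_mat complex_of_real A"
  have C: "?C \<in> carrier_mat n n" using A by simp
  obtain as where as: "char_poly ?C = (\<Prod>a\<leftarrow>as. [:- a, 1:])" "length as = n"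
    using char_poly_factorized[OF C] by blast
  obtain a as' where "as = a # as'" using as(2) n by (cases as) auto
  then have "poly (char_poly ?C) a = 0" using as(1) by simp
  then obtain v where v: "v \<in> carrier_vec n" "v \<noteq> 0\<^sub>v n" "?C *\<^sub>v v = a \<cdot>\<^sub>v v"
    using eigenvalue_root_char_poly[OF C] C by (auto simp: eigenvalue_def eigenvector_def)
  define q where "q = (\<Sum>i<n. v $ i * cnj (v $ i))"
  have "q \<noteq> 0"
  proof
    assume "q = 0"
    then have "(\<Sum>i<n. (cmod (v $ i))\<^sup>2) = 0"
      unfolding q_def complex_norm_square[symmetric] of_real_sum[symmetric] by (simp only: of_real_eq_0_iff)
    then have "\<forall>i<n. v $ i = 0" by (simp add: sum_nonneg_eq_0_iff)
    then have "v = 0\<^sub>v n" using v(1) by (intro eq_vecI) auto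
    then show False using v(2) by simp
  qed
  have row: "a * v $ i = (\<Sum>j<n. A $$ (i, j) * v $ j)" if "i < n" for i
  proof -
    have "(?C *\<^sub>v v) $ i = (\<Sum>j<n. A $$ (i, j) * v $ j)"
      using that A v(1) by (simp add: scalar_prod_def lessThan_atLeast0)
    then show ?thesis using that v by simp
  qed
  have "a * q = (\<Sum>i<n. \<Sum>j<n. A $$ (i, j) * v $ j * cnj (v $ i))"
    unfolding q_def sum_distrib_left
  proof (intro sum.cong refl)
    fix i assume "i \<in> {..<n}"
    then show "a * (v $ i * cnj (v $ i)) = (\<Sum>j<n. A $$ (i, j) * v $ j * cnj (v $ i))"
      using row[of i] by (simp add: sum_distrib_right mult.assoc[symmetric])
  qed
  moreover have "cnj \<dots> = \<dots>"
  proof -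
    have "A $$ (i, j) = A $$ (j, i)" if "i < n" "j < n" for i j
      using that A arg_cong[OF sym, of "\<lambda>M. M $$ (i, j)"] by simp
    then show ?thesis
      by (subst sum.swap) (auto simp: mult_ac intro!: sum.cong)
  qed
  moreover have "cnj q = q" by (simp add: q_def mult.commute)
  ultimately have "cnj a * q = a * q" by (metis complex_cnj_mult)
  then have "cnj a = a" using \<open>q \<noteq> 0\<close> by simp
  then have "a = complex_of_real (Re a)" by (simp add: complex_eq_iff)
  moreover have "poly (char_poly ?C) (complex_of_real x) = complex_of_real (poly (char_poly A) x)" for x
    unfolding of_real_hom.char_poly_hom[OF A] by (rule of_real_hom.poly_map_poly)
  ultimately have "poly (char_poly A) (Re a) = 0"
    using \<open>poly (char_poly ?C) a = 0\<close> by (metis of_real_eq_0_iff)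
  then show thesis using that eigenvalue_root_char_poly[OF A] by blast
qed

lemma mat_diag_Cons:
  "mat_diag (Suc m) ((!) (e # es)) =
     four_block_mat (mat 1 1 (\<lambda>_. e)) (0\<^sub>m 1 m) (0\<^sub>m m 1) (mat_diag m ((!) es))"
  by (rule eq_matI) (auto simp: mat_diag_def nth_Cons')

text \<open>Deflation: in an orthonormal basis that starts with an eigenvector, the first column of
  the matrix is \<open>e\<close> followed by zeros, by symmetry so is the first row, and the
  induction hypothesis applies to the remaining block.\<close>

lemma real_symmetric_diagonalization:
  fixes A :: "real mat"
  assumes "A \<in> carrier_mat n n" "A\<^sup>T = A"
  shows "\<exists>P es. P \<in> carrier_mat n n \<and> length es = n \<and> P\<^sup>T * P = 1\<^sub>m n
     \<and> P\<^sup>T * A * P = mat_diag n ((!) es)"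
  using assms
proof (induction n arbitrary: A)
  case 0
  then show ?case by (intro exI[of _ "1\<^sub>m 0"] exI[of _ "[]"]) (auto simp: mat_diag_def)
next
  case (Suc m)
  note A = Suc.prems(1)
  obtain e where "eigenvalue A e" using symmetric_real_eigenvalue[OF Suc.prems] by auto
  then obtain v where v: "v \<in> carrier_vec (Suc m)" "v \<noteq> 0\<^sub>v (Suc m)" "A *\<^sub>v v = e \<cdot>\<^sub>v v"
    using A by (auto simp: eigenvalue_def eigenvector_def)
  obtain W k where W: "W \<in> carrier_mat (Suc m) (Suc m)" "W\<^sup>T * W = 1\<^sub>m (Suc m)" "col W 0 = k \<cdot>\<^sub>v v"
    using orthonormal_extension[OF v(1,2)] by metis
  have Wt: "W\<^sup>T \<in> carrier_mat (Suc m) (Suc m)" using W(1) by simp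
  define B where "B = W\<^sup>T * A * W"
  have B: "B \<in> carrier_mat (Suc m) (Suc m)" using A W(1) by (simp add: B_def)
  have "B\<^sup>T = W\<^sup>T * (A\<^sup>T * W\<^sup>T\<^sup>T)"
    unfolding B_def using A W(1) Wt
    by (subst transpose_mult[of _ "Suc m" "Suc m" _ "Suc m"], auto)
      (subst transpose_mult[of _ "Suc m" "Suc m" _ "Suc m"], auto)
  also have "\<dots> = B" unfolding B_def using A W(1) Wt Suc.prems(2) by simp
  finally have symB: "B $$ (i, j) = B $$ (j, i)" if "i < Suc m" "j < Suc m" for i j
    using that B by (metis carrier_matD index_transpose_mat(1))
  have Aw: "A *\<^sub>v col W 0 = e \<cdot>\<^sub>v col W 0"
    using A v by (simp add: W(3) mult_mat_vec smult_smult_assoc mult.commute)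
  have B0: "B $$ (i, 0) = (if i = 0 then e else 0)" if "i < Suc m" for i
  proof -
    have "B = W\<^sup>T * (A * W)" using A W(1) Wt by (simp add: B_def)
    then have "B $$ (i, 0) = row (W\<^sup>T) i \<bullet> col (A * W) 0" using that A W(1) by simp
    also have "col (A * W) 0 = A *\<^sub>v col W 0" using A W(1) by auto
    also note Aw
    also have "row (W\<^sup>T) i \<bullet> (e \<cdot>\<^sub>v col W 0) = e * (row (W\<^sup>T) i \<bullet> col W 0)"
      using W(1) that by (intro scalar_prod_smult_right) auto
    also have "row (W\<^sup>T) i \<bullet> col W 0 = (W\<^sup>T * W) $$ (i, 0)" using that W(1) by simp
    also have "\<dots> = (if i = 0 then 1 else 0)" using that by (simp add: W(2))
    finally show ?thesis by simp
  qed
  define A3 where "A3 = mat m m (\<lambda>(i, j). B $$ (Suc i, Suc j))"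
  have A3: "A3 \<in> carrier_mat m m" "A3\<^sup>T = A3"
    using symB by (auto simp: A3_def)
  have Bblock: "B = four_block_mat (mat 1 1 (\<lambda>_. e)) (0\<^sub>m 1 m) (0\<^sub>m m 1) A3"
    using B B0 symB[of 0] by (intro eq_matI) (auto simp: A3_def)
  obtain P es where P: "P \<in> carrier_mat m m" "length es = m" "P\<^sup>T * P = 1\<^sub>m m"
    "P\<^sup>T * A3 * P = mat_diag m ((!) es)" using Suc.IH[OF A3] by blast
  \<comment> \<open>Fixes the eigenvector and diagonalizes the remaining block; \<open>W * Q\<close>
    is the orthogonal matrix sought.\<close>
  define Q where "Q = four_block_mat (1\<^sub>m 1) (0\<^sub>m 1 m) (0\<^sub>m m 1) P"
  have Q: "Q \<in> carrier_mat (Suc m) (Suc m)" using P(1) by (auto simp: Q_def)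
  have Qt: "Q\<^sup>T = four_block_mat (1\<^sub>m 1) (0\<^sub>m 1 m) (0\<^sub>m m 1) (P\<^sup>T)"
    unfolding Q_def using P(1) by (subst transpose_four_block_mat[of _ 1 1 _ m _ m]) auto
  have Qtc: "Q\<^sup>T \<in> carrier_mat (Suc m) (Suc m)" using Q by simp
  have PtA: "P\<^sup>T * A3 \<in> carrier_mat m m" using P(1) A3(1) by simp
  have PtQ: "(W * Q)\<^sup>T = Q\<^sup>T * W\<^sup>T" using W(1) Q by (rule transpose_mult)
  have "(W * Q)\<^sup>T * (W * Q) = Q\<^sup>T * ((W\<^sup>T * W) * Q)"
    unfolding PtQ using W(1) Wt Q Qtc
    by (simp add: assoc_mult_mat[of _ "Suc m" "Suc m" _ "Suc m" _ "Suc m"])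
  also have "\<dots> = Q\<^sup>T * Q" by (simp add: W(2) left_mult_one_mat[OF Q])
  also have "\<dots> = 1\<^sub>m (Suc m)"
    unfolding Qt unfolding Q_def using P(1) by (subst mult_four_block_mat[of _ 1 1 _ m _ m]) (auto simp: P(3))
  finally have orth: "(W * Q)\<^sup>T * (W * Q) = 1\<^sub>m (Suc m)" .
  have "(W * Q)\<^sup>T * A * (W * Q) = Q\<^sup>T * B * Q"
    unfolding PtQ B_def using W(1) Wt Q Qtc A
    by (simp add: assoc_mult_mat[of _ "Suc m" "Suc m" _ "Suc m" _ "Suc m"])
  also have "\<dots> = four_block_mat (mat 1 1 (\<lambda>_. e)) (0\<^sub>m 1 m) (0\<^sub>m m 1) (P\<^sup>T * A3) * Q"
    unfolding Qt Bblock using P(1) A3(1)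
    by (subst mult_four_block_mat[of _ 1 1 _ m _ m]) auto
  also have "\<dots> = four_block_mat (mat 1 1 (\<lambda>_. e)) (0\<^sub>m 1 m) (0\<^sub>m m 1) (P\<^sup>T * A3 * P)"
    unfolding Q_def using P(1) A3(1) PtA by (subst mult_four_block_mat[of _ 1 1 _ m _ m]) auto
  also have "\<dots> = mat_diag (Suc m) ((!) (e # es))" by (simp only: P(4) mat_diag_Cons)
  finally show ?case
    using orth W(1) Q P(2) by (intro exI[of _ "W * Q"] exI[of _ "e # es"]) simp
qed


text \<open>As \<open>P\<close> is orthogonal, \<open>A\<close> is similar to the diagonal matrix of
  \<open>es\<close>, so \<open>es\<close> lists the roots of the characteristic polynomial with
  multiplicity. The last three facts allow computing in eigenvector coordinates.\<close>

lemma real_symmetric_spectral_form: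
  fixes A :: "real mat"
  assumes A: "A \<in> carrier_mat n n" and sym: "A\<^sup>T = A"
  obtains P es where "P \<in> carrier_mat n n" "length es = n" "proots (char_poly A) = mset es"
    "\<And>w. w \<in> carrier_vec n \<Longrightarrow> P\<^sup>T *\<^sub>v (P *\<^sub>v w) = w"
    "\<And>x. x \<in> carrier_vec n \<Longrightarrow> P *\<^sub>v (P\<^sup>T *\<^sub>v x) = x"
    "\<And>w. w \<in> carrier_vec n \<Longrightarrow> P\<^sup>T *\<^sub>v (A *\<^sub>v (P *\<^sub>v w)) = vec n (\<lambda>i. es ! i * w $ i)"
proof -
  obtain P es where P: "P \<in> carrier_mat n n" "length es = n" "P\<^sup>T * P = 1\<^sub>m n"
    "P\<^sup>T * A * P = mat_diag n ((!) es)"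
    using real_symmetric_diagonalization[OF assms] by blast
  let ?D = "mat_diag n ((!) es)"
  have Pt: "P\<^sup>T \<in> carrier_mat n n" using P(1) by simp
  have PPt: "P * P\<^sup>T = 1\<^sub>m n" by (rule mat_mult_left_right_inverse[OF Pt P(1,3)])
  have "similar_mat_wit ?D A (P\<^sup>T) P"
    using P Pt PPt A by (intro similar_mat_witI[of _ _ n]) auto
  then have "similar_mat ?D A" by (auto simp: similar_mat_def)
  then have "char_poly A = char_poly ?D" by (rule char_poly_similar[symmetric])
  also have "\<dots> = (\<Prod>a\<leftarrow>diag_mat ?D. [:- a, 1:])"
    by (rule char_poly_upper_triangular[of _ n]) (auto simp: mat_diag_def)
  also have "diag_mat ?D = es"
    using P(2) by (intro nth_equalityI) (auto simp: diag_mat_def mat_diag_def)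
  also have "proots (\<Prod>a\<leftarrow>es. [:- a, 1:]) = mset es"
  proof (induction es)
    case (Cons a es)
    have "(\<Prod>a\<leftarrow>es. [:- a, 1:]) \<noteq> 0" by auto
    then show ?case using Cons by (simp add: proots_mult del: mult_pCons_left)
  qed simp
  finally have roots: "proots (char_poly A) = mset es" .
  have 1: "P\<^sup>T *\<^sub>v (P *\<^sub>v w) = w" if "w \<in> carrier_vec n" for w
    using assoc_mult_mat_vec[OF Pt P(1) that] that by (simp add: P(3))
  have 2: "P *\<^sub>v (P\<^sup>T *\<^sub>v x) = x" if "x \<in> carrier_vec n" for x
    using assoc_mult_mat_vec[OF P(1) Pt that] that by (simp add: PPt)
  have 3: "P\<^sup>T *\<^sub>v (A *\<^sub>v (P *\<^sub>v w)) = vec n (\<lambda>i. es ! i * w $ i)" if w: "w \<in> carrier_vec n" for w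
  proof -
    have "P\<^sup>T *\<^sub>v (A *\<^sub>v (P *\<^sub>v w)) = (P\<^sup>T * A * P) *\<^sub>v w"
      using w P(1) Pt A by (simp add: assoc_mult_mat_vec[of _ n n _ n])
    also have "\<dots> = vec n (\<lambda>i. es ! i * w $ i)"
    proof (rule eq_vecI)
      fix i assume "i < dim_vec (vec n (\<lambda>i. es ! i * w $ i))"
      then have i: "i < n" by simp
      have "(?D *\<^sub>v w) $ i = (\<Sum>j<n. (if i = j then es ! j else 0) * w $ j)"
        using i w by (simp add: mat_diag_def scalar_prod_def lessThan_atLeast0)
      also have "\<dots> = (\<Sum>j<n. if i = j then es ! j * w $ j else 0)"
        by (rule sum.cong) auto
      also have "\<dots> = es ! i * w $ i" using i by simp
      finally show "((P\<^sup>T * A * P) *\<^sub>v w) $ i = vec n (\<lambda>i. es ! i * w $ i) $ i"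
        using i by (simp add: P(4))
    qed (simp add: P(4) mat_diag_def)
    finally show ?thesis .
  qed
  show thesis using that[OF P(1,2) roots 1 2 3] .
qed

section \<open>The second smallest eigenvalue and the quadratic form\<close>

lemma nth_1_sort_ge_iff:
  fixes xs :: "'a::linorder list"
  assumes "length xs \<ge> 2"
  shows "c \<le> sort xs ! 1 \<longleftrightarrow> card {i. i < length xs \<and> xs ! i < c} \<le> 1"
proof -
  have "card {i. i < length xs \<and> xs ! i < c} = length (filter (\<lambda>x. x < c) (sort xs))"
    unfolding filter_sort length_sort length_filter_conv_card ..
  moreover have "length (sort xs) \<ge> 2" "sorted (sort xs)" using assms by simp_all
  moreover have "c \<le> ys ! 1 \<longleftrightarrow> length (filter (\<lambda>x. x < c) ys) \<le> 1"
    if len: "length ys \<ge> 2" and sorted: "sorted ys" for ys :: "'a list"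
  proof -
    obtain a b zs where ys: "ys = a # b # zs" using len by (cases ys; cases "tl ys") auto
    show ?thesis
    proof (cases "c \<le> b")
      case True
      then have "filter (\<lambda>x. x < c) zs = []" using sorted ys by (auto simp: filter_empty_conv)
      then show ?thesis using True ys by auto
    next
      case False
      then show ?thesis using sorted ys by auto
    qed
  qed
  ultimately show ?thesis by simp
qed

lemma scalar_prod_sq: "x \<bullet> x = (\<Sum>i<n. (x $ i)\<^sup>2)" if "x \<in> carrier_vec n" for x :: "real vec"
  using that by (simp add: scalar_prod_def lessThan_atLeast0 power2_eq_square)

context
  fixes A :: "real mat" and n :: nat and u :: "real vec"
  assumes A: "A \<in> carrier_mat n n" and sym: "A\<^sup>T = A" and n: "n \<ge> 2"
    and u: "u \<in> carrier_vec n"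
begin

text \<open>At most one eigenvalue lies below \<open>c\<close>, and since \<open>c > 0\<close> this
  place is taken by the eigenvalue 0 of \<open>u\<close>. The subtracted term is the squared
  coordinate of \<open>x\<close> along \<open>u\<close>; every other coordinate has an eigenvalue of
  at least \<open>c\<close>.\<close>

lemma quadratic_form_ge_if_second_eigenvalue_ge:
  assumes u0: "u \<noteq> 0\<^sub>v n" "A *\<^sub>v u = 0\<^sub>v n"
    and c: "c > 0" "c \<le> sorted_list_of_multiset (proots (char_poly A)) ! 1"
    and x: "x \<in> carrier_vec n"
  shows "c * (x \<bullet> x - (u \<bullet> x)\<^sup>2 / (u \<bullet> u)) \<le> x \<bullet> (A *\<^sub>v x)"
proof -
  from real_symmetric_spectral_form[OF A sym]
  obtain P es where P: "P \<in> carrier_mat n n" "length es = n" "proots (char_poly A) = mset es"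
    "\<And>w. w \<in> carrier_vec n \<Longrightarrow> P\<^sup>T *\<^sub>v (P *\<^sub>v w) = w"
    "\<And>x. x \<in> carrier_vec n \<Longrightarrow> P *\<^sub>v (P\<^sup>T *\<^sub>v x) = x"
    "\<And>w. w \<in> carrier_vec n \<Longrightarrow> P\<^sup>T *\<^sub>v (A *\<^sub>v (P *\<^sub>v w)) = vec n (\<lambda>i. es ! i * w $ i)"
    by blast
  have Pt: "P\<^sup>T \<in> carrier_mat n n" using P(1) by simp
  define y where "y = P\<^sup>T *\<^sub>v u"
  define z where "z = P\<^sup>T *\<^sub>v x"
  have y: "y \<in> carrier_vec n" and z: "z \<in> carrier_vec n" using Pt u x by (simp_all add: y_def z_def)
  have uy: "u = P *\<^sub>v y" and xz: "x = P *\<^sub>v z" using P(5) u x by (simp_all add: y_def z_def)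
  have prod: "(P *\<^sub>v a) \<bullet> b = a \<bullet> (P\<^sup>T *\<^sub>v b)" if "a \<in> carrier_vec n" "b \<in> carrier_vec n" for a b
    using transpose_vec_mult_scalar[OF Pt that(2,1)] by simp
  have isom: "(P *\<^sub>v a) \<bullet> (P *\<^sub>v b) = a \<bullet> b" if "a \<in> carrier_vec n" "b \<in> carrier_vec n" for a b
    using that P(1,4) by (simp add: prod)
  \<comment> \<open>Position 1 of the sorted list holds the second smallest eigenvalue, so at most
    one entry of \<open>es\<close> is below \<open>c\<close>.\<close>
  have "card {i. i < length es \<and> es ! i < c} \<le> 1"
    using c(2) n P(2,3) nth_1_sort_ge_iff[of es c] by simp
  then have unique: "i = j" if "i < n" "j < n" "es ! i < c" "es ! j < c" for i j
    using that P(2) by (simp add: card_le_Suc0_iff_eq)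
  have "vec n (\<lambda>i. es ! i * y $ i) = P\<^sup>T *\<^sub>v 0\<^sub>v n"
    using P(6)[OF y] unfolding uy[symmetric] u0(2) by simp
  also have "\<dots> = 0\<^sub>v n" using P(1) by (intro eq_vecI) auto
  finally have "vec n (\<lambda>i. es ! i * y $ i) $ i = 0\<^sub>v n $ i" for i by (rule arg_cong)
  then have ker: "es ! i * y $ i = 0" if "i < n" for i
    using that by (metis index_vec index_zero_vec(1))
  have "\<not> (\<forall>k<n. y $ k = 0)"
  proof
    assume "\<forall>k<n. y $ k = 0"
    then have "y = 0\<^sub>v n" using y by (intro eq_vecI) auto
    then have "P *\<^sub>v y = 0\<^sub>v n" using P(1) by (intro eq_vecI) auto
    then show False using u0(1) uy by simp
  qed
  then obtain k where k: "k < n" "y $ k \<noteq> 0" by blast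
  have esk: "es ! k = 0" using ker[OF k(1)] k(2) by simp
  have other: "c \<le> es ! i" if "i < n" "i \<noteq> k" for i
    using unique[OF that(1) k(1)] that(2) c(1) esk by fastforce
  have y0: "y $ i = 0" if "i < n" "i \<noteq> k" for i
    using ker[OF that(1)] other[OF that] c(1) by auto
  have sum_k: "(\<Sum>i<n. y $ i * h i) = y $ k * h k" for h
  proof -
    have "(\<Sum>i<n. y $ i * h i) = (\<Sum>i\<in>{k}. y $ i * h i)"
      using k(1) y0 by (intro sum.mono_neutral_right) auto
    then show ?thesis by simp
  qed
  have "u \<bullet> u = y \<bullet> y" "u \<bullet> x = y \<bullet> z" and xz': "x \<bullet> x = z \<bullet> z"
    using isom[OF y y] isom[OF y z] isom[OF z z] by (simp_all flip: uy xz)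
  then have "u \<bullet> u = (y $ k)\<^sup>2" "u \<bullet> x = y $ k * z $ k"
    using y z sum_k by (simp_all add: scalar_prod_def lessThan_atLeast0 power2_eq_square)
  then have zk: "(u \<bullet> x)\<^sup>2 / (u \<bullet> u) = (z $ k)\<^sup>2" using k(2) by (simp add: power_mult_distrib)
  have xx: "x \<bullet> x = (\<Sum>i<n. (z $ i)\<^sup>2)" using z by (simp add: xz' scalar_prod_sq)
  have "x \<bullet> (A *\<^sub>v x) = z \<bullet> vec n (\<lambda>i. es ! i * z $ i)"
    using prod[OF z, of "A *\<^sub>v x"] A x P(6)[OF z] by (simp flip: xz)
  also have "\<dots> = (\<Sum>i<n. es ! i * (z $ i)\<^sup>2)"
    by (simp add: scalar_prod_def lessThan_atLeast0 power2_eq_square mult_ac)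
  finally have xAx: "x \<bullet> (A *\<^sub>v x) = (\<Sum>i<n. es ! i * (z $ i)\<^sup>2)" .
  have "c * (x \<bullet> x - (z $ k)\<^sup>2) = (\<Sum>i\<in>{..<n} - {k}. c * (z $ i)\<^sup>2)"
    using k(1) by (simp add: xx sum_diff1 right_diff_distrib sum_distrib_left)
  also have "\<dots> \<le> (\<Sum>i\<in>{..<n} - {k}. es ! i * (z $ i)\<^sup>2)"
    using other by (intro sum_mono mult_right_mono) auto
  also have "\<dots> = x \<bullet> (A *\<^sub>v x)"
    using k(1) esk by (simp add: xAx sum_diff1)
  finally show ?thesis unfolding zk .
qed

text \<open>If two eigenvalues were below \<open>c\<close>, the plane spanned by their eigenvectors
  would contain a nonzero vector orthogonal to \<open>u\<close>, and there the form is smaller than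
  \<open>c\<close> times the squared norm.\<close>

lemma second_eigenvalue_ge_if_quadratic_form_ge:
  assumes form: "\<And>x. x \<in> carrier_vec n \<Longrightarrow> u \<bullet> x = 0 \<Longrightarrow> c * (x \<bullet> x) \<le> x \<bullet> (A *\<^sub>v x)"
  shows "c \<le> sorted_list_of_multiset (proots (char_poly A)) ! 1"
proof -
  from real_symmetric_spectral_form[OF A sym]
  obtain P es where P: "P \<in> carrier_mat n n" "length es = n" "proots (char_poly A) = mset es"
    "\<And>w. w \<in> carrier_vec n \<Longrightarrow> P\<^sup>T *\<^sub>v (P *\<^sub>v w) = w"
    "\<And>x. x \<in> carrier_vec n \<Longrightarrow> P *\<^sub>v (P\<^sup>T *\<^sub>v x) = x"
    "\<And>w. w \<in> carrier_vec n \<Longrightarrow> P\<^sup>T *\<^sub>v (A *\<^sub>v (P *\<^sub>v w)) = vec n (\<lambda>i. es ! i * w $ i)"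
    by blast
  have Pt: "P\<^sup>T \<in> carrier_mat n n" using P(1) by simp
  define y where "y = P\<^sup>T *\<^sub>v u"
  have y: "y \<in> carrier_vec n" using Pt u by (simp add: y_def)
  have prod: "(P *\<^sub>v a) \<bullet> b = a \<bullet> (P\<^sup>T *\<^sub>v b)" if "a \<in> carrier_vec n" "b \<in> carrier_vec n" for a b
    using transpose_vec_mult_scalar[OF Pt that(2,1)] by simp
  have "i = j" if ij: "i < n" "j < n" "es ! i < c" "es ! j < c" for i j
  proof (rule ccontr)
    assume "i \<noteq> j"
    \<comment> \<open>Orthogonality to \<open>u\<close> is one linear equation in two unknowns, so
      it has a nonzero solution.\<close>
    obtain \<alpha> \<beta> where ab: "\<alpha> * y $ i + \<beta> * y $ j = 0" "\<alpha> \<noteq> 0 \<or> \<beta> \<noteq> 0"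
    proof (cases "y $ i = 0 \<and> y $ j = 0")
      case True
      then show thesis using that[of 1 0] by simp
    next
      case False
      then show thesis using that[of "y $ j" "- y $ i"] by auto
    qed
    define w where "w = vec n (\<lambda>k. if k = i then \<alpha> else if k = j then \<beta> else 0)"
    have w: "w \<in> carrier_vec n" "w $ i = \<alpha>" "w $ j = \<beta>" using ij \<open>i \<noteq> j\<close> by (auto simp: w_def)
    have sum_ij: "(\<Sum>k<n. h k * w $ k) = h i * \<alpha> + h j * \<beta>" for h
    proof -
      have "(\<Sum>k<n. h k * w $ k) = (\<Sum>k\<in>{i, j}. h k * w $ k)"
        using ij by (intro sum.mono_neutral_right) (auto simp: w_def)
      then show ?thesis using w \<open>i \<noteq> j\<close> by simp
    qed
    define x where "x = P *\<^sub>v w"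
    have x: "x \<in> carrier_vec n" using P(1) w by (simp add: x_def)
    have "u \<bullet> x = w \<bullet> y" unfolding y_def x_def
      using prod[OF w(1) u] comm_scalar_prod[OF u x[unfolded x_def]] by simp
    also have "\<dots> = (\<Sum>k<n. y $ k * w $ k)"
      using y by (simp add: scalar_prod_def lessThan_atLeast0 mult.commute)
    also have "\<dots> = y $ i * \<alpha> + y $ j * \<beta>" by (rule sum_ij)
    finally have "u \<bullet> x = 0" using ab(1) by (simp add: mult.commute)
    then have "c * (x \<bullet> x) \<le> x \<bullet> (A *\<^sub>v x)" by (rule form[OF x])
    also have "x \<bullet> (A *\<^sub>v x) = w \<bullet> vec n (\<lambda>i. es ! i * w $ i)"
      using prod[OF w(1), of "A *\<^sub>v x"] A x P(6)[OF w(1)] by (simp flip: x_def)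
    also have "\<dots> = (\<Sum>k<n. (es ! k * w $ k) * w $ k)"
      by (simp add: scalar_prod_def lessThan_atLeast0 mult_ac)
    also have "\<dots> = es ! i * \<alpha>\<^sup>2 + es ! j * \<beta>\<^sup>2"
      unfolding sum_ij by (simp add: w power2_eq_square)
    also have "x \<bullet> x = (\<Sum>k<n. w $ k * w $ k)"
      using prod[OF w(1) x] P(4)[OF w(1)] w(1) by (simp add: x_def scalar_prod_def lessThan_atLeast0)
    also have "\<dots> = \<alpha>\<^sup>2 + \<beta>\<^sup>2"
      unfolding sum_ij by (simp add: w power2_eq_square)
    finally have "(c - es ! i) * \<alpha>\<^sup>2 + (c - es ! j) * \<beta>\<^sup>2 \<le> 0" by (simp add: algebra_simps)
    moreover have "(c - es ! i) * \<alpha>\<^sup>2 \<ge> 0" "(c - es ! j) * \<beta>\<^sup>2 \<ge> 0" using ij by simp_all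
    moreover have "(c - es ! i) * \<alpha>\<^sup>2 > 0 \<or> (c - es ! j) * \<beta>\<^sup>2 > 0" using ij ab(2) by auto
    ultimately show False by linarith
  qed
  then have "card {i. i < length es \<and> es ! i < c} \<le> 1"
    using P(2) by (simp add: card_le_Suc0_iff_eq)
  then show ?thesis using n P(2,3) nth_1_sort_ge_iff[of es c] by simp
qed

end


section \<open>Triangle-free graphs with a bounded Laplacian form\<close>

lemma sum_nat_layers:
  fixes f :: "'a \<Rightarrow> nat"
  assumes "finite S" "\<And>a. a \<in> S \<Longrightarrow> f a \<le> m"
  shows "sum f S = (\<Sum>k<m. card {a \<in> S. k < f a})"
proof -
  have "f a = (\<Sum>k<m. if k < f a then 1 else 0)" if "a \<in> S" for a
  proof -
    have "{..<m} \<inter> {k. k < f a} = {..<f a}" using assms(2)[OF that] by auto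
    then show ?thesis by (simp add: sum.If_cases)
  qed
  then have "sum f S = (\<Sum>a\<in>S. \<Sum>k<m. if k < f a then 1 else 0)" by (simp cong: sum.cong)
  also have "\<dots> = (\<Sum>k<m. \<Sum>a\<in>S. if k < f a then 1 else 0)" by (rule sum.swap)
  also have "\<dots> = (\<Sum>k<m. card {a \<in> S. k < f a})"
    using assms(1) by (simp add: sum.If_cases Int_def)
  finally show ?thesis .
qed

text \<open>For each \<open>k\<close>, the neighbours in \<open>T\<close> of the level set where
  \<open>f\<close> exceeds \<open>k\<close> lie in the level set where \<open>h\<close> exceeds
  \<open>k\<close>. Applying \<open>nmp\<close> to every level set and summing over \<open>k\<close>
  compares the average of \<open>f\<close> with that of \<open>h\<close>.\<close>

lemma normalized_matching_sum_le:
  fixes f :: "'a \<Rightarrow> nat" and h :: "'b \<Rightarrow> nat"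
  assumes fin: "finite S" "finite T"
    and nmp: "\<And>A. A \<subseteq> S \<Longrightarrow> card A * card T \<le> card ((\<Union>a\<in>A. R a) \<inter> T) * card S"
    and le: "\<And>a b. a \<in> S \<Longrightarrow> b \<in> R a \<Longrightarrow> b \<in> T \<Longrightarrow> f a \<le> h b"
  shows "sum f S * card T \<le> sum h T * card S"
proof -
  \<comment> \<open>A common bound for \<open>f\<close> and \<open>h\<close>, so that both sums run
    over the same layers.\<close>
  define m where "m = sum f S + sum h T"
  have fm: "f a \<le> m" if "a \<in> S" for a
    using member_le_sum[OF that _ fin(1), of f] by (simp add: m_def)
  have hm: "h b \<le> m" if "b \<in> T" for b
    using member_le_sum[OF that _ fin(2), of h] by (simp add: m_def)
  have layer: "card {a \<in> S. k < f a} * card T \<le> card {b \<in> T. k < h b} * card S" for k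
  proof -
    have "(\<Union>a\<in>{a \<in> S. k < f a}. R a) \<inter> T \<subseteq> {b \<in> T. k < h b}"
      using le by fastforce
    then have "card ((\<Union>a\<in>{a \<in> S. k < f a}. R a) \<inter> T) \<le> card {b \<in> T. k < h b}"
      using fin(2) by (intro card_mono) auto
    then show ?thesis
      by (intro order_trans[OF nmp mult_le_mono1]) auto
  qed
  have "sum f S * card T = (\<Sum>k<m. card {a \<in> S. k < f a} * card T)"
    using sum_nat_layers[of S f m, OF fin(1) fm] by (simp add: sum_distrib_right)
  also have "\<dots> \<le> (\<Sum>k<m. card {b \<in> T. k < h b} * card S)"
    by (intro sum_mono layer)
  also have "\<dots> = sum h T * card S"
    using sum_nat_layers[of T h m, OF fin(2) hm] by (simp add: sum_distrib_right)
  finally show ?thesis .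
qed

text \<open>The arithmetic behind the test vector. The first four variables are the sizes of T, S1,
  S2 and Z; \<open>e\<close> counts the edges between S1 and S2, \<open>N\<^sub>1\<close> and
  \<open>N\<^sub>2\<close> those from S1 and S2 to Z, and \<open>GT\<close> is the total of degree
  minus \<open>n / 3\<close> over T. \<open>F\<close> is the form at the test vector.\<close>

lemma block_inequality:
  fixes t s\<^sub>1 s\<^sub>2 z e N\<^sub>1 N\<^sub>2 GT n :: real
  assumes pos: "t > 0" "s\<^sub>1 > 0" "s\<^sub>2 > 0"
    and n: "n = t + s\<^sub>1 + s\<^sub>2 + z"
    and I: "n / 3 \<le> s\<^sub>1 + t" "n / 3 \<le> s\<^sub>2 + t"
    and e: "e \<le> s\<^sub>1 * s\<^sub>2"
    and N: "N\<^sub>1 * s\<^sub>2 + N\<^sub>2 * s\<^sub>1 \<le> z * (s\<^sub>1 * s\<^sub>2)"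
    and G: "0 \<le> e + N\<^sub>1 - s\<^sub>1 * n / 3" "0 \<le> e + N\<^sub>2 - s\<^sub>2 * n / 3"
    and F: "0 \<le> (- 1 / (2 * t))\<^sup>2 * GT + (1 / s\<^sub>1)\<^sup>2 * (e + N\<^sub>1 - s\<^sub>1 * n / 3)
              + (1 / s\<^sub>2)\<^sup>2 * (e + N\<^sub>2 - s\<^sub>2 * n / 3) + 3 / 4 - 2 * (1 / s\<^sub>1) * (1 / s\<^sub>2) * e"
  shows "t\<^sup>2 \<le> GT"
proof -
  \<comment> \<open>\<open>c\<close> is the edge density between S1 and S2; \<open>A\<^sub>1\<close>
    and \<open>A\<^sub>2\<close> are the averages of degree minus \<open>n / 3\<close>. Only their
    sum has a good upper bound, so \<open>s\<^sub>1\<close> and \<open>s\<^sub>2\<close> are both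
    replaced by their minimum \<open>m\<close> as denominators.\<close>
  define m where "m = min s\<^sub>1 s\<^sub>2"
  define c where "c = e / (s\<^sub>1 * s\<^sub>2)"
  define A\<^sub>1 where "A\<^sub>1 = (e + N\<^sub>1 - s\<^sub>1 * n / 3) / s\<^sub>1"
  define A\<^sub>2 where "A\<^sub>2 = (e + N\<^sub>2 - s\<^sub>2 * n / 3) / s\<^sub>2"
  have m: "m > 0" "m \<le> s\<^sub>1" "m \<le> s\<^sub>2" "n / 3 - t \<le> m" using pos I by (auto simp: m_def)
  have A: "0 \<le> A\<^sub>1" "0 \<le> A\<^sub>2" using G pos by (auto simp: A\<^sub>1_def A\<^sub>2_def)
  have c: "c \<le> 1" using e pos by (simp add: c_def)
  have "A\<^sub>1 + A\<^sub>2 = c * (s\<^sub>1 + s\<^sub>2) + (N\<^sub>1 * s\<^sub>2 + N\<^sub>2 * s\<^sub>1) / (s\<^sub>1 * s\<^sub>2) - 2 * n / 3"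
    using pos by (simp add: A\<^sub>1_def A\<^sub>2_def c_def field_simps)
  also have "\<dots> \<le> c * (s\<^sub>1 + s\<^sub>2) + z - 2 * n / 3"
    using N pos by (simp add: divide_le_eq)
  also have "\<dots> \<le> m - (1 - c) * (s\<^sub>1 + s\<^sub>2)"
  proof -
    have "z - 2 * n / 3 \<le> m - (s\<^sub>1 + s\<^sub>2)" using m(4) n by linarith
    then show ?thesis by (simp add: algebra_simps)
  qed
  also have "\<dots> \<le> m - (1 - c) * (2 * m)"
    using mult_left_mono[of "2 * m" "s\<^sub>1 + s\<^sub>2" "1 - c"] c m by simp
  finally have "A\<^sub>1 + A\<^sub>2 \<le> (2 * c - 1) * m" by (simp add: algebra_simps)
  then have "(A\<^sub>1 + A\<^sub>2) / m \<le> 2 * c - 1" using m(1) by (simp add: pos_divide_le_eq)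
  moreover have "A\<^sub>1 / s\<^sub>1 \<le> A\<^sub>1 / m" "A\<^sub>2 / s\<^sub>2 \<le> A\<^sub>2 / m"
    using A m pos by (auto intro!: divide_left_mono)
  ultimately have "A\<^sub>1 / s\<^sub>1 + A\<^sub>2 / s\<^sub>2 \<le> 2 * c - 1"
    by (simp add: add_divide_distrib)
  moreover have "(1 / s\<^sub>1)\<^sup>2 * (e + N\<^sub>1 - s\<^sub>1 * n / 3) = A\<^sub>1 / s\<^sub>1"
    "(1 / s\<^sub>2)\<^sup>2 * (e + N\<^sub>2 - s\<^sub>2 * n / 3) = A\<^sub>2 / s\<^sub>2"
    by (simp_all add: A\<^sub>1_def A\<^sub>2_def power2_eq_square)
  moreover have "2 * (1 / s\<^sub>1) * (1 / s\<^sub>2) * e = 2 * c" by (simp add: c_def)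
  ultimately have "1 / 4 \<le> (- 1 / (2 * t))\<^sup>2 * GT" using F by linarith
  then show ?thesis using pos(1) by (simp add: power2_eq_square field_simps)
qed

text \<open>The hypothesis on the algebraic connectivity without matrices: \<open>N\<close> gives
  the neighbourhoods, \<open>N_disjoint\<close> excludes triangles and loops, and
  \<open>form_nonneg\<close> says that the Laplacian form at \<open>x\<close> is at least
  \<open>n / 3\<close> times the squared distance of \<open>x\<close> from the constant
  vectors.\<close>

locale laplacian_bounded_graph =
  fixes V :: "'a set" and N :: "'a \<Rightarrow> 'a set"
  assumes finite_V: "finite V"
    and N_subset: "N v \<subseteq> V"
    and N_sym: "u \<in> N v \<Longrightarrow> v \<in> N u"
    and N_disjoint: "u \<in> N v \<Longrightarrow> N u \<inter> N v = {}"
    and form_nonneg: "0 \<le> (\<Sum>v\<in>V. (real (card (N v)) - real (card V) / 3) * (x v)\<^sup>2)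
                 + (\<Sum>v\<in>V. x v)\<^sup>2 / 3 - (\<Sum>v\<in>V. \<Sum>u\<in>N v. x u * x v)"
begin

definition excess :: "'a \<Rightarrow> real" where
  "excess v = real (card (N v)) - real (card V) / 3"

definition indep :: "'a set \<Rightarrow> bool" where
  "indep A \<longleftrightarrow> A \<subseteq> V \<and> (\<forall>v\<in>A. N v \<inter> A = {})"

lemma finite_N [simp, intro]: "finite (N v)"
  using N_subset finite_V by (rule finite_subset)

lemma N_irrefl: "v \<notin> N v"
  using N_disjoint[of v v] by auto

lemma N_sym_iff: "u \<in> N v \<longleftrightarrow> v \<in> N u"
  using N_sym by blast

lemma indep_finite: "indep A \<Longrightarrow> finite A"
  using finite_V finite_subset by (auto simp: indep_def)

lemma indep_N: "indep (N v)"
  using N_subset N_disjoint by (fastforce simp: indep_def)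

lemma indepD: "indep A \<Longrightarrow> v \<in> A \<Longrightarrow> u \<in> A \<Longrightarrow> u \<notin> N v"
  by (auto simp: indep_def)

lemma sum_card_N_swap:
  assumes "finite B" "finite C"
  shows "(\<Sum>v\<in>B. card (N v \<inter> C)) = (\<Sum>v\<in>C. card (N v \<inter> B))"
proof -
  have "(\<Sum>v\<in>B. card (N v \<inter> C)) = (\<Sum>v\<in>B. \<Sum>u\<in>C. if u \<in> N v then 1 else 0)"
    using assms by (simp add: sum.If_cases Int_commute)
  also have "\<dots> = (\<Sum>u\<in>C. \<Sum>v\<in>B. if v \<in> N u then 1 else 0)"
    by (subst sum.swap) (simp add: N_sym_iff)
  also have "\<dots> = (\<Sum>v\<in>C. card (N v \<inter> B))"
    using assms by (simp add: sum.If_cases Int_commute)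
  finally show ?thesis .
qed

text \<open>The form at a vector that is constant on each of three blocks and 0 elsewhere. By
  independence only arcs between \<open>B\<close> and \<open>C\<close> contribute, in both
  directions, whence the factor 2.\<close>

lemma form_blocks_nonneg:
  assumes ABC: "indep (A \<union> B)" "indep (A \<union> C)"
    and disj: "A \<inter> B = {}" "A \<inter> C = {}" "B \<inter> C = {}"
  shows "0 \<le> \<alpha>\<^sup>2 * sum excess A + \<beta>\<^sup>2 * sum excess B + \<gamma>\<^sup>2 * sum excess C
           + (\<alpha> * card A + \<beta> * card B + \<gamma> * card C)\<^sup>2 / 3
           - 2 * \<beta> * \<gamma> * (\<Sum>v\<in>B. card (N v \<inter> C))"
proof -
  define x where "x v = (if v \<in> A then \<alpha> else if v \<in> B then \<beta> else if v \<in> C then \<gamma> else 0)" for v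
  have sub: "A \<union> B \<union> C \<subseteq> V" using ABC by (auto simp: indep_def)
  have fin: "finite A" "finite B" "finite C"
    using ABC[THEN indep_finite] by auto
  have split: "sum h V = sum h A + sum h B + sum h C"
    if "\<And>v. v \<notin> A \<union> B \<union> C \<Longrightarrow> h v = 0" for h :: "'a \<Rightarrow> real"
  proof -
    have "sum h V = sum h (A \<union> B \<union> C)"
      using that finite_V sub by (intro sum.mono_neutral_right) auto
    also have "\<dots> = sum h (A \<union> B) + sum h C"
      using fin disj by (intro sum.union_disjoint) auto
    also have "sum h (A \<union> B) = sum h A + sum h B"
      using fin disj by (intro sum.union_disjoint) auto
    finally show ?thesis .
  qed
  have x: "\<And>v. v \<in> A \<Longrightarrow> x v = \<alpha>" "\<And>v. v \<in> B \<Longrightarrow> x v = \<beta>" "\<And>v. v \<in> C \<Longrightarrow> x v = \<gamma>"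
    "\<And>v. v \<notin> A \<union> B \<union> C \<Longrightarrow> x v = 0"
    using disj by (auto simp: x_def)
  have 1: "(\<Sum>v\<in>V. excess v * (x v)\<^sup>2) = \<alpha>\<^sup>2 * sum excess A + \<beta>\<^sup>2 * sum excess B + \<gamma>\<^sup>2 * sum excess C"
    by (subst split) (simp_all add: x sum_distrib_right mult.commute cong: sum.cong)
  have 2: "(\<Sum>v\<in>V. x v) = \<alpha> * card A + \<beta> * card B + \<gamma> * card C"
    by (subst split) (simp_all add: x mult.commute cong: sum.cong)
  have N_A: "(\<Sum>u\<in>N v. x u * x v) = 0" if "v \<in> A" for v
  proof (rule sum.neutral, rule ballI)
    fix u assume "u \<in> N v"
    then have "u \<notin> A \<union> B \<union> C" using that indepD[OF ABC(1)] indepD[OF ABC(2)] by auto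
    then show "x u * x v = 0" using x(4) by simp
  qed
  have N_B: "(\<Sum>u\<in>N v. x u * x v) = \<beta> * \<gamma> * card (N v \<inter> C)" if "v \<in> B" for v
  proof -
    have "u \<notin> A \<union> B" if "u \<in> N v" for u using that \<open>v \<in> B\<close> indepD[OF ABC(1)] by auto
    then have "(\<Sum>u\<in>N v. x u * x v) = (\<Sum>u\<in>N v. if u \<in> C then \<gamma> * \<beta> else 0)"
      using x(2)[OF that] by (intro sum.cong) (auto simp: x_def)
    also have "\<dots> = \<beta> * \<gamma> * card (N v \<inter> C)" by (simp add: sum.If_cases)
    finally show ?thesis .
  qed
  have N_C: "(\<Sum>u\<in>N v. x u * x v) = \<beta> * \<gamma> * card (N v \<inter> B)" if "v \<in> C" for v
  proof -
    have "u \<notin> A \<union> C" if "u \<in> N v" for u using that \<open>v \<in> C\<close> indepD[OF ABC(2)] by auto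
    then have "(\<Sum>u\<in>N v. x u * x v) = (\<Sum>u\<in>N v. if u \<in> B then \<beta> * \<gamma> else 0)"
      using x(3)[OF that] by (intro sum.cong) (auto simp: x_def)
    also have "\<dots> = \<beta> * \<gamma> * card (N v \<inter> B)" by (simp add: sum.If_cases)
    finally show ?thesis .
  qed
  have 3: "(\<Sum>v\<in>V. \<Sum>u\<in>N v. x u * x v) = 2 * \<beta> * \<gamma> * (\<Sum>v\<in>B. card (N v \<inter> C))"
  proof -
    have "(\<Sum>v\<in>V. \<Sum>u\<in>N v. x u * x v)
        = \<beta> * \<gamma> * (\<Sum>v\<in>B. card (N v \<inter> C)) + \<beta> * \<gamma> * (\<Sum>v\<in>C. card (N v \<inter> B))"
      by (subst split) (simp_all add: x(4) N_A N_B N_C sum_distrib_left cong: sum.cong)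
    then show ?thesis by (simp add: sum_card_N_swap[OF fin(2,3)])
  qed
  show ?thesis
    using form_nonneg[of x] unfolding excess_def[symmetric] 1 2 3 by simp
qed

text \<open>At the indicator vector of the edge the form is
  \<open>excess u + excess v + 4 / 3 - 2\<close>.\<close>

lemma excess_edge:
  assumes "u \<in> N v"
  shows "excess u + excess v \<ge> 2 / 3"
proof -
  have V: "u \<in> V" "v \<in> V" using assms N_subset N_sym by blast+
  have "u \<noteq> v" using assms N_irrefl by auto
  moreover have "N v \<inter> {u} = {u}" using assms by auto
  ultimately show ?thesis
    using form_blocks_nonneg[of "{}" "{v}" "{u}" 0 1 1] V N_irrefl by (simp add: indep_def)
qed

text \<open>The indicator vector of \<open>v\<close> only shows that three times the degree is at
  least \<open>card V - 1\<close>. In the case of equality, a small change at a second vertex would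
  make the form negative; strictness and integrality then give the bound.\<close>

lemma excess_nonneg:
  assumes "v \<in> V" "card V \<ge> 2"
  shows "excess v \<ge> 0"
proof -
  have single: "excess w + 1 / 3 \<ge> 0" if "w \<in> V" for w
    using form_blocks_nonneg[of "{}" "{w}" "{}" 0 1 0] that N_irrefl
    by (simp add: indep_def)
  have "\<not> V \<subseteq> {v}" using assms(2) card_mono[of "{v}" V] by auto
  then obtain u where u: "u \<in> V" "u \<noteq> v" by auto
  define p where "p = excess u + 1 / 3"
  \<comment> \<open>Half the coefficient of the mixed term in the values at \<open>v\<close> and
    \<open>u\<close>: it is \<open>1 / 3\<close> or \<open>- 2 / 3\<close>, hence never 0.\<close>
  define c :: real where "c = 1 / 3 - card (N v \<inter> {u})"
  have "c \<noteq> 0" by (cases "u \<in> N v") (auto simp: c_def)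
  have "0 \<le> excess v + s\<^sup>2 * excess u + (1 + s)\<^sup>2 / 3 - 2 * s * card (N v \<inter> {u})" for s
    using form_blocks_nonneg[of "{}" "{v}" "{u}" 0 1 s] u assms N_irrefl
    by (simp add: indep_def)
  then have s: "0 \<le> (excess v + 1 / 3) + s\<^sup>2 * p + 2 * s * c" for s
    by (simp add: p_def c_def power2_eq_square algebra_simps add_divide_distrib)
  have p: "p \<ge> 0" using single u by (simp add: p_def)
  have "excess v + 1 / 3 > 0"
  proof (rule ccontr)
    assume "\<not> ?thesis"
    then have "excess v + 1 / 3 = 0" using single[OF assms(1)] by simp
    \<comment> \<open>Close to the minimizer of the quadratic in \<open>s\<close>; the denominator
      \<open>p + 1\<close> is positive even for \<open>p = 0\<close>.\<close>
    moreover define k where "k = c / (p + 1)"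
    ultimately have "0 \<le> k\<^sup>2 * p - 2 * k * c" using s[of "- k"] by simp
    also have "c = k * (p + 1)" using p by (simp add: k_def)
    also have "k\<^sup>2 * p - 2 * k * (k * (p + 1)) = - (k\<^sup>2 * (p + 2))"
      by (simp add: power2_eq_square algebra_simps)
    also have "\<dots> < 0" using p \<open>c \<noteq> 0\<close> by (simp add: k_def)
    finally show False by simp
  qed
  then have "card V < 3 * card (N v) + 1" by (simp add: excess_def)
  then show ?thesis by (simp add: excess_def)
qed

section \<open>Good pairs of independent sets\<close>

definition good_pair :: "'a set \<Rightarrow> 'a set \<Rightarrow> bool" where
  "good_pair I J \<longleftrightarrow> indep I \<and> indep J \<and> card V \<le> 3 * card I \<and> card V \<le> 3 * card J
     \<and> I \<inter> J \<noteq> {} \<and> \<not> indep (I \<union> J)"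

lemma good_pair_sym: "good_pair I J \<Longrightarrow> good_pair J I"
  by (auto simp: good_pair_def Int_commute Un_commute)

lemma maximal_indep_superset:
  assumes "indep A"
  obtains M where "A \<subseteq> M" "indep M" "\<And>B. M \<subseteq> B \<Longrightarrow> indep B \<Longrightarrow> B = M"
proof -
  have "finite {B. indep B}"
    by (rule finite_subset[of _ "Pow V"]) (auto simp: indep_def finite_V)
  from finite_has_maximal2[OF this, of A] assms
  obtain M where "indep M" "A \<subseteq> M" "\<forall>B\<in>{B. indep B}. M \<subseteq> B \<longrightarrow> M = B"
    by auto
  then show thesis using that[of M] by auto
qed

lemma bipartition_if_no_good_pair:
  assumes "card V \<ge> 2" and no_good: "\<And>I J. \<not> good_pair I J"
  shows "\<exists>X Y. X \<union> Y = V \<and> X \<inter> Y = {}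
     \<and> (\<forall>v. \<forall>u\<in>N v. (v \<in> X \<and> u \<in> Y) \<or> (v \<in> Y \<and> u \<in> X))"
proof -
  have large: "card V \<le> 3 * card (N v)" if "v \<in> V" for v
    using excess_nonneg[OF that assms(1)] by (simp add: excess_def)
  have nonempty: "N v \<noteq> {}" if "v \<in> V" for v
    using large[OF that] assms(1) by auto
  have "V \<noteq> {}" using assms(1) by auto
  then obtain p q where pq: "p \<in> V" "q \<in> N p" using nonempty by blast
  then have qV: "q \<in> V" and qp: "p \<in> N q" using N_subset N_sym by blast+
  obtain A where A: "N p \<subseteq> A" "indep A" "\<And>B. A \<subseteq> B \<Longrightarrow> indep B \<Longrightarrow> B = A"
    using maximal_indep_superset[OF indep_N] by metis
  obtain B where B: "N q \<subseteq> B" "indep B" "\<And>C. B \<subseteq> C \<Longrightarrow> indep C \<Longrightarrow> C = B"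
    using maximal_indep_superset[OF indep_N] by metis
  have cA: "card (N p) \<le> card A" and cB: "card (N q) \<le> card B"
    using A B indep_finite by (auto intro: card_mono)
  \<comment> \<open>A maximal independent set of this size contains every neighbourhood that it
    meets, since the two sets cannot form a good pair.\<close>
  have inside: "N v \<subseteq> M"
    if "v \<in> V" "N v \<inter> M \<noteq> {}" "indep M" "card V \<le> 3 * card M"
      "\<And>C. M \<subseteq> C \<Longrightarrow> indep C \<Longrightarrow> C = M" for v M
  proof -
    have "indep (N v \<union> M)"
      using no_good[of "N v" M] that large indep_N by (auto simp: good_pair_def)
    then show ?thesis using that(5)[of "N v \<union> M"] by auto
  qed
  have lA: "card V \<le> 3 * card A" and lB: "card V \<le> 3 * card B"
    using large[OF pq(1)] large[OF qV] cA cB by linarith+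
  \<comment> \<open>\<open>q\<close> lies in \<open>A\<close>, \<open>p\<close> lies in
    \<open>B\<close>, and they are adjacent, so the union is not independent.\<close>
  have AB: "A \<inter> B = {}"
  proof (rule ccontr)
    assume "A \<inter> B \<noteq> {}"
    then have "indep (A \<union> B)" using no_good[of A B] A B lA lB by (auto simp: good_pair_def)
    then show False using A(1) B(1) pq(2) qp indepD by blast
  qed
  \<comment> \<open>A neighbourhood avoiding both sets would leave them at most two thirds of the
    vertices, but the degrees of the adjacent \<open>p\<close> and \<open>q\<close> add up to more
    than that by \<open>excess_edge\<close>.\<close>
  have cover: "N v \<subseteq> A \<or> N v \<subseteq> B" if "v \<in> V" for v
  proof (rule ccontr)
    assume *: "\<not> ?thesis"
    then have "N v \<inter> A = {}" "N v \<inter> B = {}"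
      using inside[OF that _ A(2) lA A(3)] inside[OF that _ B(2) lB B(3)] by blast+
    then have "card (N v) + card A + card B = card (N v \<union> A \<union> B)"
      using AB A B indep_finite by (subst card_Un_disjoint, auto)+
    also have "\<dots> \<le> card V"
      using N_subset A(2) B(2) finite_V by (intro card_mono) (auto simp: indep_def)
    finally have "real (card (N v)) + real (card (N p)) + real (card (N q)) \<le> real (card V)"
      using cA cB by linarith
    moreover have "real (card V) \<le> 3 * real (card (N v))" using large[OF that] by linarith
    ultimately show False using excess_edge[OF pq(2)] by (simp add: excess_def)
  qed
  \<comment> \<open>Two adjacent vertices in the same class would lie in each other's neighbourhood,
    hence both in \<open>A\<close> or both in \<open>B\<close>.\<close>
  let ?X = "{v \<in> V. N v \<subseteq> A}" and ?Y = "{v \<in> V. N v \<subseteq> B}"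
  have "?X \<union> ?Y = V" using cover by auto
  moreover have "?X \<inter> ?Y = {}" using AB nonempty by blast
  moreover have "(v \<in> ?X \<and> u \<in> ?Y) \<or> (v \<in> ?Y \<and> u \<in> ?X)" if u: "u \<in> N v" for u v
  proof -
    have v: "v \<in> N u" using u N_sym by blast
    then have "u \<in> V" "v \<in> V" using u N_subset by blast+
    moreover have "\<not> (N v \<subseteq> A \<and> N u \<subseteq> A)" "\<not> (N v \<subseteq> B \<and> N u \<subseteq> B)"
      using u v indepD[OF A(2)] indepD[OF B(2)] by blast+
    ultimately show ?thesis using cover by blast
  qed
  ultimately show ?thesis by (intro exI[of _ ?X] exI[of _ ?Y] conjI) auto
qed

text \<open>By symmetry of good pairs the larger set is put first. This gives
  \<open>card S\<^sub>2 \<le> card S\<^sub>1\<close>, which turns the plain matching inequality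
  \<open>card A \<le> card B\<close> below into the normalized one.\<close>

lemma no_maximal_good_pair:
  assumes "card V \<ge> 2" and IJ: "good_pair I J" "card J \<le> card I"
    and max: "\<And>I' J'. good_pair I' J' \<Longrightarrow> card I' + card J' \<le> card I + card J"
  shows False
proof -
  define T where "T = I \<inter> J"
  define S\<^sub>1 where "S\<^sub>1 = I - J"
  define S\<^sub>2 where "S\<^sub>2 = J - I"
  define Z where "Z = V - (I \<union> J)"
  note defs = T_def S\<^sub>1_def S\<^sub>2_def Z_def
  have iI: "indep I" and iJ: "indep J" and T0: "T \<noteq> {}"
    and large: "card V \<le> 3 * card I" "card V \<le> 3 * card J"
    and dep: "\<not> indep (I \<union> J)"
    using IJ by (auto simp: good_pair_def T_def)
  have IJV: "I \<subseteq> V" "J \<subseteq> V" using iI iJ by (auto simp: indep_def)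
  have fin [simp, intro]: "finite I" "finite J" "finite T" "finite S\<^sub>1" "finite S\<^sub>2" "finite Z"
    using iI iJ indep_finite finite_V by (auto simp: defs)
  have IT: "I = T \<union> S\<^sub>1" and JT: "J = T \<union> S\<^sub>2" by (auto simp: defs)
  have cI: "card I = card T + card S\<^sub>1"
    unfolding IT by (rule card_Un_disjoint) (auto simp: defs)
  have cJ: "card J = card T + card S\<^sub>2"
    unfolding JT by (rule card_Un_disjoint) (auto simp: defs)
  have "V = I \<union> S\<^sub>2 \<union> Z" using IJV by (auto simp: defs)
  then have "card V = card (I \<union> S\<^sub>2 \<union> Z)" by (rule arg_cong)
  also have "\<dots> = card (I \<union> S\<^sub>2) + card Z" by (rule card_Un_disjoint) (auto simp: defs finite_V)
  finally have "card V = card (I \<union> S\<^sub>2) + card Z" .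
  moreover have "card (I \<union> S\<^sub>2) = card I + card S\<^sub>2"
    by (rule card_Un_disjoint) (auto simp: defs)
  ultimately have cV: "card V = card T + card S\<^sub>1 + card S\<^sub>2 + card Z" using cI by simp
  \<comment> \<open>\<open>I\<close> and \<open>J\<close> are independent, so an edge inside their
    union joins \<open>S\<^sub>1\<close> to \<open>S\<^sub>2\<close>.\<close>
  obtain a\<^sub>0 b\<^sub>0 where ab\<^sub>0: "a\<^sub>0 \<in> S\<^sub>1" "b\<^sub>0 \<in> S\<^sub>2" "b\<^sub>0 \<in> N a\<^sub>0"
  proof -
    obtain a b where ab: "a \<in> I \<union> J" "b \<in> I \<union> J" "b \<in> N a" "a \<in> N b"
      using dep IJV N_sym by (auto simp: indep_def)
    then have "a \<in> S\<^sub>1 \<and> b \<in> S\<^sub>2 \<or> b \<in> S\<^sub>1 \<and> a \<in> S\<^sub>2"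
      using indepD[OF iI] indepD[OF iJ] by (auto simp: defs)
    then show thesis using ab that by blast
  qed
  have N_T: "N v \<subseteq> Z" if "v \<in> T" for v
    using that N_subset[of v] indepD[OF iI, of v] indepD[OF iJ, of v] by (auto simp: defs)
  have N_S1: "N v \<subseteq> S\<^sub>2 \<union> Z" if "v \<in> S\<^sub>1" for v
    using that N_subset[of v] indepD[OF iI, of v] by (auto simp: defs)
  have N_S2: "N v \<subseteq> S\<^sub>1 \<union> Z" if "v \<in> S\<^sub>2" for v
    using that N_subset[of v] indepD[OF iJ, of v] by (auto simp: defs)
  \<comment> \<open>Otherwise \<open>b\<close> could be added to \<open>I\<close>, giving a larger
    good pair.\<close>
  have matched: "N b \<inter> S\<^sub>1 \<noteq> {}" if b: "b \<in> S\<^sub>2" for b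
  proof
    assume "N b \<inter> S\<^sub>1 = {}"
    then have "N b \<inter> I = {}" using N_S2[OF b] by (auto simp: defs)
    moreover have "b \<notin> N v" if "v \<in> I" for v using \<open>N b \<inter> I = {}\<close> that N_sym[of b v] by blast
    ultimately have "indep (insert b I)"
      using iI b IJV N_irrefl[of b] by (auto simp: indep_def defs)
    moreover have "insert b I \<union> J = I \<union> J" "b \<notin> I" using b by (auto simp: defs)
    ultimately have "good_pair (insert b I) J" using IJ by (auto simp: good_pair_def)
    from max[OF this] show False using \<open>b \<notin> I\<close> by simp
  qed
  have nmp: "card A * card S\<^sub>2 \<le> card ((\<Union>a\<in>A. N a) \<inter> S\<^sub>2) * card S\<^sub>1" if A: "A \<subseteq> S\<^sub>1" for A
  proof -
    define B where "B = (\<Union>a\<in>A. N a) \<inter> S\<^sub>2"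
    have finA: "finite A" "finite B" using A finite_subset by (auto simp: B_def)
    show ?thesis
    proof (cases "S\<^sub>2 \<subseteq> B")
      case True
      then have "B = S\<^sub>2" by (auto simp: B_def)
      then show ?thesis using card_mono[OF _ A] by (simp add: B_def)
    next
      case False
      then obtain b where b: "b \<in> S\<^sub>2" "b \<notin> B" by auto
      then obtain a where a: "a \<in> N b" "a \<in> S\<^sub>1" using matched by blast
      \<comment> \<open>Exchange \<open>B\<close> for \<open>A\<close> in \<open>J\<close>. The
        result is independent, because all neighbours of \<open>A\<close> in \<open>J\<close> lie in
        \<open>B\<close>, and the edge from \<open>a\<close> to \<open>b\<close> stays inside the
        union with \<open>I\<close>. By maximality \<open>A\<close> is not larger than
        \<open>B\<close>.\<close>
      define J' where "J' = (J - B) \<union> A"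
      have "card A \<le> card B"
      proof (rule ccontr)
        assume less: "\<not> ?thesis"
        have "card J' = card (J - B) + card A"
          unfolding J'_def using A finA by (intro card_Un_disjoint) (auto simp: defs)
        also have "card (J - B) = card J - card B"
          by (rule card_Diff_subset) (auto simp: B_def defs)
        also have "card B \<le> card J" by (rule card_mono) (auto simp: B_def defs)
        ultimately have bigger: "card J < card J'" using less by linarith
        have "u \<notin> N v" if uv: "u \<in> J'" "v \<in> J'" for u v
        proof -
          have AJ: "y \<notin> N x" if "x \<in> A" "y \<in> J - B" for x y
            using that A N_S1[of x] by (auto simp: B_def defs)
          have AA: "y \<notin> N x" if "x \<in> A" "y \<in> A" for x y
            using that A indepD[OF iI] by (auto simp: defs)
          consider "u \<in> J - B" "v \<in> J - B" | "u \<in> J - B" "v \<in> A" | "u \<in> A" "v \<in> J - B"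
            | "u \<in> A" "v \<in> A" using uv by (auto simp: J'_def)
          then show ?thesis
          proof cases
            case 1
            then show ?thesis using indepD[OF iJ, of v u] by simp
          next
            case 3
            then show ?thesis using AJ[of u v] N_sym[of u v] by blast
          qed (use AJ AA in blast)+
        qed
        then have "indep J'" using A IJV by (fastforce simp: J'_def indep_def defs)
        moreover have "T \<subseteq> I \<inter> J'" by (auto simp: J'_def B_def defs)
        moreover have "\<not> indep (I \<union> J')"
        proof -
          have "a \<in> I \<union> J'" "b \<in> I \<union> J'" using a b by (auto simp: J'_def defs)
          then show ?thesis using a(1) indepD by blast
        qed
        ultimately have "good_pair I J'" using iI large T0 bigger by (auto simp: good_pair_def)
        from max[OF this] show False using bigger by simp
      qed
      moreover have "card S\<^sub>2 \<le> card S\<^sub>1" using IJ(2) cI cJ by simp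
      ultimately show ?thesis unfolding B_def[symmetric] by (rule mult_le_mono)
    qed
  qed
  define \<nu> where "\<nu> v = card (N v \<inter> Z)" for v
  define e where "e = (\<Sum>v\<in>S\<^sub>1. card (N v \<inter> S\<^sub>2))"
  have \<nu>_edge: "\<nu> a + \<nu> b \<le> card Z" if "b \<in> N a" for a b
  proof -
    have "\<nu> a + \<nu> b = card (N a \<inter> Z \<union> N b \<inter> Z)"
      unfolding \<nu>_def using N_disjoint[OF that] by (subst card_Un_disjoint) auto
    also have "\<dots> \<le> card Z" by (rule card_mono) auto
    finally show ?thesis .
  qed
  \<comment> \<open>On an edge, \<open>\<nu> a \<le> card Z - \<nu> b\<close>; the average of
    \<open>\<nu>\<close> over \<open>S\<^sub>1\<close> is thus at most that of
    \<open>card Z - \<nu>\<close> over \<open>S\<^sub>2\<close>. No truncation occurs, as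
    \<open>\<nu>\<close> is at most \<open>card Z\<close>.\<close>
  define h where "h = (\<Sum>b\<in>S\<^sub>2. card Z - \<nu> b)"
  have "sum \<nu> S\<^sub>1 * card S\<^sub>2 \<le> h * card S\<^sub>1"
    unfolding h_def
  proof (rule normalized_matching_sum_le[where R = N])
    fix a b assume "b \<in> N a"
    then show "\<nu> a \<le> card Z - \<nu> b" using \<nu>_edge[of b a] by linarith
  qed (use nmp in auto)
  then have "sum \<nu> S\<^sub>1 * card S\<^sub>2 + sum \<nu> S\<^sub>2 * card S\<^sub>1 \<le> (h + sum \<nu> S\<^sub>2) * card S\<^sub>1"
    by (simp add: add_mult_distrib)
  also have "h + sum \<nu> S\<^sub>2 = card S\<^sub>2 * card Z"
  proof -
    have "\<nu> b \<le> card Z" for b unfolding \<nu>_def by (rule card_mono) auto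
    then show ?thesis by (simp add: h_def flip: sum.distrib)
  qed
  finally have "sum \<nu> S\<^sub>1 * card S\<^sub>2 + sum \<nu> S\<^sub>2 * card S\<^sub>1 \<le> card Z * (card S\<^sub>1 * card S\<^sub>2)"
    by (simp add: ac_simps)
  then have N12: "real (sum \<nu> S\<^sub>1) * card S\<^sub>2 + real (sum \<nu> S\<^sub>2) * card S\<^sub>1
      \<le> real (card Z) * (real (card S\<^sub>1) * real (card S\<^sub>2))"
    by (metis of_nat_add of_nat_le_iff of_nat_mult)
  have deg1: "card (N v) = card (N v \<inter> S\<^sub>2) + \<nu> v" if "v \<in> S\<^sub>1" for v
  proof -
    have "N v = N v \<inter> S\<^sub>2 \<union> N v \<inter> Z" using N_S1[OF that] by auto
    then show ?thesis unfolding \<nu>_def by (subst card_Un_disjoint[symmetric]) (auto simp: defs)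
  qed
  have deg2: "card (N v) = card (N v \<inter> S\<^sub>1) + \<nu> v" if "v \<in> S\<^sub>2" for v
  proof -
    have "N v = N v \<inter> S\<^sub>1 \<union> N v \<inter> Z" using N_S2[OF that] by auto
    then show ?thesis unfolding \<nu>_def by (subst card_Un_disjoint[symmetric]) (auto simp: defs)
  qed
  have "(\<Sum>v\<in>S\<^sub>1. card (N v)) = e + sum \<nu> S\<^sub>1"
    by (simp add: deg1 e_def sum.distrib cong: sum.cong)
  then have G1: "sum excess S\<^sub>1 = real e + real (sum \<nu> S\<^sub>1) - real (card S\<^sub>1) * real (card V) / 3"
    by (simp add: excess_def sum_subtractf flip: of_nat_sum)
  have "(\<Sum>v\<in>S\<^sub>2. card (N v)) = e + sum \<nu> S\<^sub>2"
    by (simp add: deg2 e_def sum.distrib sum_card_N_swap[of S\<^sub>1 S\<^sub>2] cong: sum.cong)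
  then have G2: "sum excess S\<^sub>2 = real e + real (sum \<nu> S\<^sub>2) - real (card S\<^sub>2) * real (card V) / 3"
    by (simp add: excess_def sum_subtractf flip: of_nat_sum)
  have pos: "card T > 0" "card S\<^sub>1 > 0" "card S\<^sub>2 > 0"
    using T0 ab\<^sub>0 by (auto simp: card_gt_0_iff)
  have "e \<le> card S\<^sub>1 * card S\<^sub>2"
    unfolding e_def by (rule order_trans[OF sum_bounded_above[where K = "card S\<^sub>2"]]) (auto intro: card_mono)
  then have e: "real e \<le> real (card S\<^sub>1) * real (card S\<^sub>2)" by (metis of_nat_le_iff of_nat_mult)
  have nonneg: "0 \<le> excess v" if "v \<in> I \<union> J" for v
    using excess_nonneg that IJV assms(1) by auto
  have "(real (card T))\<^sup>2 \<le> sum excess T"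
  proof (rule block_inequality[OF _ _ _ _ _ _ e N12])
    show "0 \<le> real e + real (sum \<nu> S\<^sub>1) - real (card S\<^sub>1) * real (card V) / 3"
      unfolding G1[symmetric] using nonneg by (intro sum_nonneg) (auto simp: defs)
    show "0 \<le> real e + real (sum \<nu> S\<^sub>2) - real (card S\<^sub>2) * real (card V) / 3"
      unfolding G2[symmetric] using nonneg by (intro sum_nonneg) (auto simp: defs)
    \<comment> \<open>The test vector has total weights \<open>- 1 / 2\<close>, 1 and 1 on the three
      blocks, so the squared sum divided by 3 is \<open>3 / 4\<close>.\<close>
    have *: "(- 1 / (2 * real (card T)) * card T + 1 / real (card S\<^sub>1) * card S\<^sub>1
           + 1 / real (card S\<^sub>2) * card S\<^sub>2)\<^sup>2 / 3 = 3 / 4"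
      using pos by (simp add: card_gt_0_iff power2_eq_square)
    have "indep (T \<union> S\<^sub>1)" "indep (T \<union> S\<^sub>2)" using iI iJ IT JT by simp_all
    then show "0 \<le> (- 1 / (2 * real (card T)))\<^sup>2 * sum excess T
        + (1 / real (card S\<^sub>1))\<^sup>2 * (real e + real (sum \<nu> S\<^sub>1) - real (card S\<^sub>1) * real (card V) / 3)
        + (1 / real (card S\<^sub>2))\<^sup>2 * (real e + real (sum \<nu> S\<^sub>2) - real (card S\<^sub>2) * real (card V) / 3)
        + 3 / 4 - 2 * (1 / real (card S\<^sub>1)) * (1 / real (card S\<^sub>2)) * real e"
      unfolding G1[symmetric] G2[symmetric] unfolding e_def
      by (subst *[symmetric], intro form_blocks_nonneg) (auto simp: defs)
  qed (use pos cV cI cJ large in auto)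
  \<comment> \<open>By averaging, some vertex of \<open>T\<close> has excess at least
    \<open>card T\<close>.\<close>
  moreover have "sum excess T < real (card T) * real (card T)"
    if "\<And>y. y \<in> T \<Longrightarrow> excess y < card T"
    using sum_strict_mono[of T excess "\<lambda>_. real (card T)"] that T0 by simp
  ultimately obtain y where y: "y \<in> T" "excess y \<ge> card T"
    by (force simp: power2_eq_square)
  have "card (N y) \<le> card Z" using N_T[OF y(1)] by (intro card_mono) auto
  moreover have "real (3 * card T + card V) \<le> real (3 * card (N y))"
    using y(2) by (simp add: excess_def)
  then have "3 * card T + card V \<le> 3 * card (N y)" by (simp only: of_nat_le_iff)
  \<comment> \<open>\<open>card Z\<close> is at least the degree of \<open>y\<close>, hence at least
    a third of \<open>card V\<close> plus \<open>card T\<close>. The lower bounds on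
    \<open>I\<close> and \<open>J\<close> give the reverse inequality, so equality holds
    throughout.\<close>
  ultimately have tight: "3 * card I = card V" "3 * card J = card V" "card (N y) = card Z"
    "3 * card Z = card V + 3 * card T"
    using cV cI cJ large by linarith+
  have NyZ: "N y = Z" using N_T[OF y(1)] tight(3) by (intro card_subset_eq) auto
  \<comment> \<open>A neighbourhood inside \<open>S\<^sub>1\<close> or \<open>S\<^sub>2\<close>
    would have fewer than a third of the vertices. And \<open>Z\<close>, \<open>N a\<close> are
    together larger than \<open>I\<close>, \<open>J\<close>, so they are not a good pair although
    they meet.\<close>
  have meets: "N a \<inter> Z \<noteq> {}" and indep_Z: "indep (Z \<union> N a)" if a: "a \<in> S\<^sub>1 \<union> S\<^sub>2" for a
  proof -
    have aV: "a \<in> V" using a IJV by (auto simp: defs)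
    have la: "card V \<le> 3 * card (N a)"
      using excess_nonneg[OF aV assms(1)] by (simp add: excess_def)
    show "N a \<inter> Z \<noteq> {}"
    proof
      assume "N a \<inter> Z = {}"
      then have "N a \<subseteq> S\<^sub>2 \<or> N a \<subseteq> S\<^sub>1" using a N_S1 N_S2 by blast
      then have "card (N a) \<le> card S\<^sub>2 \<or> card (N a) \<le> card S\<^sub>1" using card_mono by blast
      then show False using la tight cI cJ pos by linarith
    qed
    then show "indep (Z \<union> N a)"
      using max[of Z "N a"] indep_N[of y] indep_N[of a] la tight pos NyZ
      by (auto simp: good_pair_def)
  qed
  \<comment> \<open>\<open>b\<^sub>0\<close> and \<open>c\<close> are adjacent and both lie in the
    independent set \<open>Z \<union> N a\<^sub>0\<close>.\<close>
  obtain c where c: "c \<in> N b\<^sub>0" "c \<in> Z" using meets[of b\<^sub>0] ab\<^sub>0 by auto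
  then show False using indepD[OF indep_Z[of a\<^sub>0], of b\<^sub>0 c] ab\<^sub>0 by auto
qed

text \<open>The sizes in a good pair add up to at most \<open>2 * card V\<close>, so a good pair
  with maximal sum would exist, and \<open>no_maximal_good_pair\<close> refutes it in one of the two
  orders.\<close>

theorem bipartition:
  assumes "card V \<ge> 2"
  shows "\<exists>X Y. X \<union> Y = V \<and> X \<inter> Y = {}
     \<and> (\<forall>v. \<forall>u\<in>N v. (v \<in> X \<and> u \<in> Y) \<or> (v \<in> Y \<and> u \<in> X))"
proof (rule bipartition_if_no_good_pair[OF assms], rule notI)
  fix I J assume "good_pair I J"
  let ?P = "\<lambda>p. good_pair (fst p) (snd p)" and ?f = "\<lambda>p. card (fst p) + card (snd p)"
  have "?f p \<le> 2 * card V" if "?P p" for p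
  proof -
    have "fst p \<subseteq> V" "snd p \<subseteq> V" using that by (auto simp only: good_pair_def indep_def)
    then have "card (fst p) \<le> card V" "card (snd p) \<le> card V"
      using finite_V by (simp_all add: card_mono)
    then show ?thesis by simp
  qed
  then have "\<forall>p. ?P p \<longrightarrow> ?f p < Suc (2 * card V)" by (intro allI impI) (simp only: less_Suc_eq_le)
  moreover have "?P (I, J)" using \<open>good_pair I J\<close> by simp
  ultimately obtain p where p: "?P p" "\<And>q. ?P q \<Longrightarrow> ?f q \<le> ?f p"
    using ex_has_greatest_nat[of ?P "(I, J)" ?f] by blast
  have max: "card I' + card J' \<le> card (fst p) + card (snd p)" if "good_pair I' J'" for I' J'
    using p(2)[of "(I', J')"] that by simp
  show False
  proof (cases "card (snd p) \<le> card (fst p)")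
    case True
    from no_maximal_good_pair[OF assms p(1) True max] show ?thesis .
  next
    case False
    have "card I' + card J' \<le> card (snd p) + card (fst p)" if "good_pair I' J'" for I' J'
      using max[OF that] by linarith
    from no_maximal_good_pair[OF assms good_pair_sym[OF p(1)] _ this] show ?thesis
      using False by simp
  qed
qed

end


section \<open>The Laplacian form and the algebraic connectivity\<close>

definition nbrs :: "'a pair_pre_digraph \<Rightarrow> 'a \<Rightarrow> 'a set" where
  "nbrs G v = {u. (v, u) \<in> parcs G}"

text \<open>For a graph this is the sum of \<open>(f u - f v)^2\<close> over the edges
  \<open>uv\<close>, split into its diagonal and its off-diagonal part.\<close>

definition laplacian_form :: "'a pair_pre_digraph \<Rightarrow> ('a \<Rightarrow> real) \<Rightarrow> real" where
  "laplacian_form G f = (\<Sum>v\<in>pverts G. real (card (nbrs G v)) * (f v)\<^sup>2)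
     - (\<Sum>v\<in>pverts G. \<Sum>u\<in>nbrs G v. f u * f v)"

context
  fixes G :: "'a pair_pre_digraph"
  assumes G: "pair_graph G"
begin

interpretation pair_graph G by (rule G)

section \<open>The Laplacian matrix in terms of neighbourhoods\<close>

lemma nbrs_subset: "nbrs G v \<subseteq> pverts G"
  using in_arcsD2 by (auto simp: nbrs_def)

lemma nbrs_sym: "u \<in> nbrs G v \<Longrightarrow> v \<in> nbrs G u"
  using pair_sym_arcs by (auto simp: nbrs_def symmetric_def dest: symD)

lemma out_degree_nbrs: "out_degree (with_proj G) v = card (nbrs G v)"
proof -
  have "out_arcs (with_proj G) v = Pair v ` nbrs G v"
    by (auto simp: out_arcs_def nbrs_def)
  then show ?thesis by (simp add: out_degree_def card_image inj_on_def)
qed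

definition vertex_vec :: "('a \<Rightarrow> real) \<Rightarrow> real vec" where
  "vertex_vec f = vec (length (vertex_enum G)) (\<lambda>i. f (vertex_enum G ! i))"

lemma length_vertex_enum: "length (vertex_enum G) = card (pverts G)"
  using vertex_enum[OF pair_finite_verts] by (metis distinct_card)

lemma vertex_vec_carrier: "vertex_vec f \<in> carrier_vec (length (vertex_enum G))"
  by (simp add: vertex_vec_def)

lemma sum_vertex_enum: "(\<Sum>i<length (vertex_enum G). g (vertex_enum G ! i)) = sum g (pverts G)"
  using sum.reindex_bij_betw[OF bij_betw_nth[of "vertex_enum G" "{..<length (vertex_enum G)}" "pverts G"]]
    vertex_enum[OF pair_finite_verts] by blast

lemma laplacian_mat_carrier: "laplacian_mat (vertex_enum G) G \<in> carrier_mat (length (vertex_enum G)) (length (vertex_enum G))"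
  by (rule carrier_matI) (simp_all add: laplacian_mat_def degree_mat_def adjacency_mat_def)

lemma laplacian_mat_symmetric: "(laplacian_mat (vertex_enum G) G)\<^sup>T = laplacian_mat (vertex_enum G) G"
  using nbrs_sym
  by (intro eq_matI) (auto simp: laplacian_mat_def degree_mat_def adjacency_mat_def nbrs_def)

lemma laplacian_mat_mult_vertex_vec:
  fixes f :: "'a \<Rightarrow> real"
  shows "laplacian_mat (vertex_enum G) G *\<^sub>v vertex_vec f = vertex_vec (\<lambda>v. card (nbrs G v) * f v - sum f (nbrs G v))"
proof (rule eq_vecI)
  fix i assume "i < dim_vec (vertex_vec (\<lambda>v. card (nbrs G v) * f v - sum f (nbrs G v)))"
  then have i: "i < length (vertex_enum G)" by (simp add: vertex_vec_def)
  have "(laplacian_mat (vertex_enum G) G *\<^sub>v vertex_vec f) $ i = (\<Sum>j<length (vertex_enum G). ((if i = j then real (card (nbrs G (vertex_enum G ! i))) else 0)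
      - (if vertex_enum G ! j \<in> nbrs G (vertex_enum G ! i) then 1 else 0)) * f (vertex_enum G ! j))"
    using i by (simp add: laplacian_mat_def degree_mat_def adjacency_mat_def vertex_vec_def
        scalar_prod_def lessThan_atLeast0 out_degree_nbrs nbrs_def cong: if_cong)
  also have "\<dots> = (\<Sum>j<length (vertex_enum G). if i = j then card (nbrs G (vertex_enum G ! i)) * f (vertex_enum G ! j) else 0)
      - (\<Sum>j<length (vertex_enum G). if vertex_enum G ! j \<in> nbrs G (vertex_enum G ! i) then f (vertex_enum G ! j) else 0)"
    unfolding sum_subtractf[symmetric] by (intro sum.cong) (auto simp: left_diff_distrib)
  also have "(\<Sum>j<length (vertex_enum G). if vertex_enum G ! j \<in> nbrs G (vertex_enum G ! i) then f (vertex_enum G ! j) else 0)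
      = (\<Sum>u\<in>pverts G. if u \<in> nbrs G (vertex_enum G ! i) then f u else 0)"
    by (rule sum_vertex_enum)
  also have "\<dots> = sum f (nbrs G (vertex_enum G ! i))"
    using nbrs_subset by (simp add: sum.If_cases Int_absorb1 Int_commute)
  finally show "(laplacian_mat (vertex_enum G) G *\<^sub>v vertex_vec f) $ i
      = vertex_vec (\<lambda>v. card (nbrs G v) * f v - sum f (nbrs G v)) $ i"
    using i by (simp add: vertex_vec_def)
qed (use laplacian_mat_carrier in \<open>simp add: vertex_vec_def\<close>)

lemma vertex_vec_scalar_prod: "vertex_vec f \<bullet> vertex_vec g = (\<Sum>v\<in>pverts G. f v * g v)"
  by (simp add: vertex_vec_def scalar_prod_def lessThan_atLeast0[symmetric]
      sum_vertex_enum[of "\<lambda>v. f v * g v"])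

lemma laplacian_form_eq: "vertex_vec f \<bullet> (laplacian_mat (vertex_enum G) G *\<^sub>v vertex_vec f) = laplacian_form G f"
  unfolding laplacian_mat_mult_vertex_vec vertex_vec_scalar_prod laplacian_form_def
  by (simp add: algebra_simps sum_subtractf sum_distrib_left power2_eq_square)

text \<open>The enumeration has no repetitions, so each vertex determines its index; statements
  about all vectors become statements about functions on vertices.\<close>

lemma vertex_vec_cases:
  assumes "x \<in> carrier_vec (length (vertex_enum G))"
  obtains f where "x = vertex_vec f"
proof -
  have "x = vertex_vec (\<lambda>v. x $ (THE i. i < length (vertex_enum G) \<and> vertex_enum G ! i = v))"
  proof (rule eq_vecI)
    fix i assume "i < dim_vec (vertex_vec (\<lambda>v. x $ (THE i. i < length (vertex_enum G) \<and> vertex_enum G ! i = v)))"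
    then have i: "i < length (vertex_enum G)" by (simp add: vertex_vec_def)
    then have "(THE j. j < length (vertex_enum G) \<and> vertex_enum G ! j = vertex_enum G ! i) = i"
      using vertex_enum(1)[OF pair_finite_verts] by (auto simp: nth_eq_iff_index_eq)
    then show "x $ i = vertex_vec (\<lambda>v. x $ (THE i. i < length (vertex_enum G) \<and> vertex_enum G ! i = v)) $ i"
      using i by (simp add: vertex_vec_def)
  qed (use assms in \<open>simp add: vertex_vec_def\<close>)
  then show thesis by (rule that)
qed

text \<open>The spectral bound with the all-ones vector, which spans the line of constants killed by
  the Laplacian, in the role of \<open>u\<close>.\<close>

lemma laplacian_form_ge_if_algebraic_connectivity_ge:
  assumes n: "card (pverts G) \<ge> 2" and c: "0 < c" "c \<le> \<mu>\<^bsub>2\<^esub> G"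
  shows "c * ((\<Sum>v\<in>pverts G. (f v)\<^sup>2) - (\<Sum>v\<in>pverts G. f v)\<^sup>2 / card (pverts G)) \<le> laplacian_form G f"
proof -
  have "vertex_vec (\<lambda>_. 1) $ 0 = 1" using n length_vertex_enum by (simp add: vertex_vec_def)
  then have "vertex_vec (\<lambda>_. 1) \<noteq> 0\<^sub>v (length (vertex_enum G))" using n length_vertex_enum by auto
  moreover have "laplacian_mat (vertex_enum G) G *\<^sub>v vertex_vec (\<lambda>_. 1) = 0\<^sub>v (length (vertex_enum G))"
    unfolding laplacian_mat_mult_vertex_vec by (simp add: vertex_vec_def zero_vec_def)
  moreover have "c \<le> sorted_list_of_multiset (proots (char_poly (laplacian_mat (vertex_enum G) G))) ! 1"
    using c(2) by (simp add: laplacian_eigenvalue_def laplacian_spectrum_def)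
  ultimately show ?thesis
    using quadratic_form_ge_if_second_eigenvalue_ge[OF laplacian_mat_carrier
        laplacian_mat_symmetric _ vertex_vec_carrier _ _ c(1) _ vertex_vec_carrier, of "\<lambda>_. 1" f]
      n length_vertex_enum
    by (simp add: laplacian_form_eq vertex_vec_scalar_prod power2_eq_square)
qed

lemma algebraic_connectivity_ge_if_laplacian_form_ge:
  assumes n: "card (pverts G) \<ge> 2"
    and form: "\<And>f. sum f (pverts G) = 0 \<Longrightarrow> c * (\<Sum>v\<in>pverts G. (f v)\<^sup>2) \<le> laplacian_form G f"
  shows "c \<le> \<mu>\<^bsub>2\<^esub> G"
proof -
  have "c \<le> sorted_list_of_multiset (proots (char_poly (laplacian_mat (vertex_enum G) G))) ! 1"
  proof (rule second_eigenvalue_ge_if_quadratic_form_ge[OF laplacian_mat_carrier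
        laplacian_mat_symmetric _ vertex_vec_carrier])
    fix x assume x: "x \<in> carrier_vec (length (vertex_enum G))" "vertex_vec (\<lambda>_. 1) \<bullet> x = 0"
    then obtain f where "x = vertex_vec f" using vertex_vec_cases by blast
    then show "c * (x \<bullet> x) \<le> x \<bullet> (laplacian_mat (vertex_enum G) G *\<^sub>v x)"
      using form[of f] x(2) by (simp add: laplacian_form_eq vertex_vec_scalar_prod power2_eq_square)
  qed (use n length_vertex_enum in simp)
  then show ?thesis by (simp add: laplacian_eigenvalue_def laplacian_spectrum_def)
qed

lemma bipartite_if_algebraic_connectivity_ge:
  assumes n: "card (pverts G) \<ge> 2" and tf: "triangle_free G"
    and \<mu>: "real (card (pverts G)) / 3 \<le> \<mu>\<^bsub>2\<^esub> G"
  shows "bipartite G"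
proof -
  interpret laplacian_bounded_graph "pverts G" "nbrs G"
  proof
    show "finite (pverts G)" by (rule pair_finite_verts)
    show "nbrs G v \<subseteq> pverts G" for v by (rule nbrs_subset)
    show "u \<in> nbrs G v \<Longrightarrow> v \<in> nbrs G u" for u v by (rule nbrs_sym)
    show "nbrs G u \<inter> nbrs G v = {}" if "u \<in> nbrs G v" for u v
      using tf that by (auto simp: triangle_free_def nbrs_def)
    fix x :: "'a \<Rightarrow> real"
    let ?n = "real (card (pverts G))"
    \<comment> \<open>With the factor \<open>?n / 3\<close>, the correction by the squared sum over
      \<open>?n\<close> becomes the squared sum over 3.\<close>
    have "?n / 3 * ((\<Sum>v\<in>pverts G. (x v)\<^sup>2) - (\<Sum>v\<in>pverts G. x v)\<^sup>2 / ?n) \<le> laplacian_form G x"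
      using n \<mu> by (intro laplacian_form_ge_if_algebraic_connectivity_ge) auto
    moreover have "?n / 3 * ((\<Sum>v\<in>pverts G. (x v)\<^sup>2) - (\<Sum>v\<in>pverts G. x v)\<^sup>2 / ?n)
        = ?n / 3 * (\<Sum>v\<in>pverts G. (x v)\<^sup>2) - (\<Sum>v\<in>pverts G. x v)\<^sup>2 / 3"
      using n by (simp add: right_diff_distrib)
    moreover have "(\<Sum>v\<in>pverts G. (real (card (nbrs G v)) - ?n / 3) * (x v)\<^sup>2)
        = (\<Sum>v\<in>pverts G. real (card (nbrs G v)) * (x v)\<^sup>2) - ?n / 3 * (\<Sum>v\<in>pverts G. (x v)\<^sup>2)"
      by (simp add: left_diff_distrib sum_subtractf sum_distrib_left)
    ultimately show "0 \<le> (\<Sum>v\<in>pverts G. (real (card (nbrs G v)) - ?n / 3) * (x v)\<^sup>2)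
        + (\<Sum>v\<in>pverts G. x v)\<^sup>2 / 3 - (\<Sum>v\<in>pverts G. \<Sum>u\<in>nbrs G v. x u * x v)"
      unfolding laplacian_form_def by linarith
  qed
  obtain X Y where "X \<union> Y = pverts G" "X \<inter> Y = {}"
    "\<forall>v. \<forall>u\<in>nbrs G v. (v \<in> X \<and> u \<in> Y) \<or> (v \<in> Y \<and> u \<in> X)"
    using bipartition[OF n] by blast
  then show ?thesis unfolding bipartite_def nbrs_def by (intro exI[of _ X] exI[of _ Y]) auto
qed

end

section \<open>Blow-ups of the pentagon\<close>

text \<open>The two singleton classes are consecutive on the pentagon. All numbers from
  \<open>2 * m + 2\<close> on get class 4; the vertex set of the blow-up stops before
  \<open>3 * m + 2\<close>.\<close>

definition pentagon_class :: "nat \<Rightarrow> nat \<Rightarrow> nat" where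
  "pentagon_class m v =
     (if v = 0 then 0 else if v = 1 then 1 else if v < m + 2 then 2 else if v < 2 * m + 2 then 3 else 4)"

definition pentagon_blowup :: "nat \<Rightarrow> nat pair_pre_digraph" where
  "pentagon_blowup m = \<lparr>pverts = {..<3 * m + 2},
     parcs = {(u, v). u < 3 * m + 2 \<and> v < 3 * m + 2 \<and>
       (pentagon_class m v = (pentagon_class m u + 1) mod 5
        \<or> pentagon_class m u = (pentagon_class m v + 1) mod 5)}\<rparr>"

lemma pentagon_class_less: "pentagon_class m v < 5"
  by (simp add: pentagon_class_def)

lemma pair_graph_pentagon_blowup: "pair_graph (pentagon_blowup m)"
proof
  fix e assume e: "e \<in> parcs (pentagon_blowup m)"
  have *: "x \<noteq> (x + 1) mod 5" if "x < 5" for x :: nat using that by presburger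
  show "fst e \<noteq> snd e"
    using e *[OF pentagon_class_less[of m "fst e"]] by (auto simp: pentagon_blowup_def)
next
  show "symmetric (with_proj (pentagon_blowup m))"
    by (auto simp: symmetric_def pentagon_blowup_def intro!: symI)
next
  have "parcs (pentagon_blowup m) \<subseteq> {..<3 * m + 2} \<times> {..<3 * m + 2}"
    by (auto simp: pentagon_blowup_def)
  then show "finite (parcs (pentagon_blowup m))" by (rule finite_subset) simp
qed (auto simp: pentagon_blowup_def)

lemma arc_pentagon_blowup_iff:
  "(u, v) \<in> parcs (pentagon_blowup m) \<longleftrightarrow> u < 3 * m + 2 \<and> v < 3 * m + 2 \<and>
     (pentagon_class m v = (pentagon_class m u + 1) mod 5
      \<or> pentagon_class m u = (pentagon_class m v + 1) mod 5)"
  by (simp only: pentagon_blowup_def pair_pre_digraph.select_convs mem_Collect_eq prod.case)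

text \<open>Three steps of 1 or -1 add up to an odd number between -3 and 3, which is not divisible
  by 5; verified by cases.\<close>

lemma no_triangle_mod_5:
  fixes i j k :: nat
  assumes less: "i < 5" "j < 5" "k < 5"
    and "j = (i + 1) mod 5 \<or> i = (j + 1) mod 5" "k = (j + 1) mod 5 \<or> j = (k + 1) mod 5"
    "k = (i + 1) mod 5 \<or> i = (k + 1) mod 5"
  shows False
proof -
  have succ: "(a + 1) mod 5 = (if a = 4 then 0 else a + 1)" if "a < 5" for a :: nat using that by auto
  note h = assms(4-6)[unfolded succ[OF less(1)] succ[OF less(2)] succ[OF less(3)]]
  consider "i = 0" | "i = 1" | "i = 2" | "i = 3" | "i = 4" using less(1) by linarith
  then show False
    by cases (use h in \<open>auto split: if_splits\<close>)
qed

lemma triangle_free_pentagon_blowup: "triangle_free (pentagon_blowup m)"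
  unfolding triangle_free_def
proof (intro notI, elim exE conjE)
  fix x y z
  assume "(x, y) \<in> parcs (pentagon_blowup m)" "(y, z) \<in> parcs (pentagon_blowup m)"
    "(x, z) \<in> parcs (pentagon_blowup m)"
  note this[unfolded arc_pentagon_blowup_iff, THEN conjunct2, THEN conjunct2]
  then show False by (rule no_triangle_mod_5[OF pentagon_class_less pentagon_class_less pentagon_class_less])
qed

lemma not_bipartite_pentagon_blowup:
  assumes "m \<ge> 1"
  shows "\<not> bipartite (pentagon_blowup m)"
proof
  assume "bipartite (pentagon_blowup m)"
  then obtain X Y where XY: "X \<inter> Y = {}"
    "\<forall>(u, v)\<in>parcs (pentagon_blowup m). (u \<in> X \<and> v \<in> Y) \<or> (u \<in> Y \<and> v \<in> X)"
    unfolding bipartite_def by (elim exE conjE)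
  have arc: "(u \<in> X \<and> v \<in> Y) \<or> (u \<in> Y \<and> v \<in> X)" if "(u, v) \<in> parcs (pentagon_blowup m)" for u v
    using bspec[OF XY(2) that] by simp
  \<comment> \<open>A 5-cycle with one vertex from each class; \<open>m \<ge> 1\<close> makes the
    classes non-empty.\<close>
  have "(0, 1) \<in> parcs (pentagon_blowup m)" "(1, 2) \<in> parcs (pentagon_blowup m)"
    "(2, m + 2) \<in> parcs (pentagon_blowup m)" "(m + 2, 2 * m + 2) \<in> parcs (pentagon_blowup m)"
    "(2 * m + 2, 0) \<in> parcs (pentagon_blowup m)"
    using assms by (simp_all add: arc_pentagon_blowup_iff pentagon_class_def)
  from this[THEN arc] show False using XY(1) by blast
qed

text \<open>Young's inequality for \<open>w\<close> and each value of \<open>f\<close>, summed over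
  \<open>S\<close>.\<close>

lemma two_mult_sum_le:
  fixes f :: "'a \<Rightarrow> real" and w \<epsilon> :: real
  assumes "\<epsilon> > 0"
  shows "2 * w * sum f S \<le> \<epsilon> * card S * w\<^sup>2 + (\<Sum>v\<in>S. (f v)\<^sup>2) / \<epsilon>"
proof -
  have "2 * w * y \<le> \<epsilon> * w\<^sup>2 + y\<^sup>2 / \<epsilon>" for y :: real
  proof -
    have "0 \<le> (\<epsilon> * w - y)\<^sup>2 / \<epsilon>" using assms by simp
    also have "\<dots> = \<epsilon> * w\<^sup>2 + y\<^sup>2 / \<epsilon> - 2 * w * y"
      using assms by (simp add: power2_eq_square field_simps)
    finally show ?thesis by simp
  qed
  then have "(\<Sum>v\<in>S. 2 * w * f v) \<le> (\<Sum>v\<in>S. \<epsilon> * w\<^sup>2 + (f v)\<^sup>2 / \<epsilon>)" by (rule sum_mono)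
  moreover have "(\<Sum>v\<in>S. 2 * w * f v) = 2 * w * sum f S" by (simp only: sum_distrib_left)
  ultimately show ?thesis
    by (simp add: sum.distrib sum_divide_distrib mult_ac)
qed

text \<open>Young's inequality moves the cross terms between the singletons and the large classes to
  the diagonal, at a cost of \<open>\<epsilon> * m\<close> and \<open>1 / \<epsilon>\<close>. The
  cross term of the middle class with its two neighbours is controlled by the vanishing sum of
  \<open>f\<close>.\<close>

lemma algebraic_connectivity_pentagon_blowup:
  assumes m: "m \<ge> 1" and \<epsilon>: "\<epsilon> > 0"
  shows "m - \<epsilon> * m - 1 / \<epsilon> - 1 \<le> \<mu>\<^bsub>2\<^esub> (pentagon_blowup m)"
proof (rule algebraic_connectivity_ge_if_laplacian_form_ge[OF pair_graph_pentagon_blowup])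
  let ?G = "pentagon_blowup m"
  show "2 \<le> card (pverts ?G)" by (simp add: pentagon_blowup_def)
  fix f :: "nat \<Rightarrow> real"
  assume f0: "sum f (pverts ?G) = 0"
  define A B C where "A = {2..<m + 2}" and "B = {m + 2..<2 * m + 2}" and "C = {2 * m + 2..<3 * m + 2}"
  have card: "card A = m" "card B = m" "card C = m" by (simp_all add: A_def B_def C_def)
  have fin: "finite A" "finite B" "finite C" by (simp_all add: A_def B_def C_def)
  have disj: "0 \<notin> A" "1 \<notin> A" "0 \<notin> B" "1 \<notin> B" "0 \<notin> C" "1 \<notin> C" "A \<inter> B = {}" "A \<inter> C = {}" "B \<inter> C = {}"
    by (auto simp: A_def B_def C_def)
  have verts: "pverts ?G = insert 0 (insert 1 (A \<union> (B \<union> C)))"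
    by (auto simp: pentagon_blowup_def A_def B_def C_def)
  have split: "sum h (pverts ?G) = h 0 + h 1 + sum h A + sum h B + sum h C" for h :: "nat \<Rightarrow> real"
  proof -
    have "sum h (A \<union> (B \<union> C)) = sum h A + (sum h B + sum h C)"
      using fin disj by (subst sum.union_disjoint, auto)+
    then show ?thesis unfolding verts using fin disj by simp
  qed
  let ?k = "pentagon_class m"
  have k_iff: "?k v = 0 \<longleftrightarrow> v = 0" "?k v = 1 \<longleftrightarrow> v = 1" "?k v = 2 \<longleftrightarrow> v \<in> A"
    "?k v = 3 \<longleftrightarrow> v \<in> B" "?k v = 4 \<longleftrightarrow> v \<in> C" if "v \<in> pverts ?G" for v
    using that m by (auto simp: pentagon_class_def pentagon_blowup_def A_def B_def C_def)
  \<comment> \<open>Adding 4 modulo 5 is the predecessor, so both adjacent classes are computed from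
    the class of \<open>v\<close>.\<close>
  have nbrs_iff: "nbrs ?G v = {u \<in> pverts ?G. ?k u = (?k v + 1) mod 5 \<or> ?k u = (?k v + 4) mod 5}"
    if "v \<in> pverts ?G" for v
  proof -
    have "x = (y + 4) mod 5 \<longleftrightarrow> y = (x + 1) mod 5" if "x < 5" "y < 5" for x y :: nat
    proof -
      have "(y + 4) mod 5 = (if y = 0 then 4 else y - 1)" using that(2) by (cases y) simp_all
      moreover have "(x + 1) mod 5 = (if x = 4 then 0 else x + 1)" using that(1) by simp
      ultimately show ?thesis using that by (simp split: if_split) linarith
    qed
    from this[OF pentagon_class_less pentagon_class_less]
    have "?k u = (?k v + 4) mod 5 \<longleftrightarrow> ?k v = (?k u + 1) mod 5" for u .
    moreover have "u \<in> pverts ?G \<longleftrightarrow> u < 3 * m + 2" for u by (simp add: pentagon_blowup_def)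
    ultimately show ?thesis using that unfolding nbrs_def arc_pentagon_blowup_iff by blast
  qed
  have nbrs: "nbrs ?G 0 = insert 1 C" "nbrs ?G 1 = insert 0 A"
    "\<And>v. v \<in> A \<Longrightarrow> nbrs ?G v = insert 1 B" "\<And>v. v \<in> B \<Longrightarrow> nbrs ?G v = A \<union> C"
    "\<And>v. v \<in> C \<Longrightarrow> nbrs ?G v = insert 0 B"
  proof -
    have k: "?k 0 = 0" "?k 1 = 1" "\<And>v. v \<in> A \<Longrightarrow> ?k v = 2" "\<And>v. v \<in> B \<Longrightarrow> ?k v = 3"
      "\<And>v. v \<in> C \<Longrightarrow> ?k v = 4"
      by (auto simp: pentagon_class_def A_def B_def C_def)
    have V: "0 \<in> pverts ?G" "1 \<in> pverts ?G" "\<And>v. v \<in> A \<Longrightarrow> v \<in> pverts ?G"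
      "\<And>v. v \<in> B \<Longrightarrow> v \<in> pverts ?G" "\<And>v. v \<in> C \<Longrightarrow> v \<in> pverts ?G"
      by (auto simp: verts)
    have mod5: "(0 + 1 :: nat) mod 5 = 1" "(0 + 4 :: nat) mod 5 = 4" "(1 + 1 :: nat) mod 5 = 2"
      "(1 + 4 :: nat) mod 5 = 0" "(2 + 1 :: nat) mod 5 = 3" "(2 + 4 :: nat) mod 5 = 1"
      "(3 + 1 :: nat) mod 5 = 4" "(3 + 4 :: nat) mod 5 = 2" "(4 + 1 :: nat) mod 5 = 0"
      "(4 + 4 :: nat) mod 5 = 3" by simp_all
    have "{u \<in> pverts ?G. ?k u = 1 \<or> ?k u = 4} = insert 1 C"
      "{u \<in> pverts ?G. ?k u = 2 \<or> ?k u = 0} = insert 0 A"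
      "{u \<in> pverts ?G. ?k u = 3 \<or> ?k u = 1} = insert 1 B"
      "{u \<in> pverts ?G. ?k u = 4 \<or> ?k u = 2} = A \<union> C"
      "{u \<in> pverts ?G. ?k u = 0 \<or> ?k u = 3} = insert 0 B"
      by (auto simp: k_iff V k simp del: One_nat_def)
    then show "nbrs ?G 0 = insert 1 C" "nbrs ?G 1 = insert 0 A"
      "\<And>v. v \<in> A \<Longrightarrow> nbrs ?G v = insert 1 B" "\<And>v. v \<in> B \<Longrightarrow> nbrs ?G v = A \<union> C"
      "\<And>v. v \<in> C \<Longrightarrow> nbrs ?G v = insert 0 B"
      by (simp_all only: nbrs_iff V k mod5)
  qed
  have AC: "card (A \<union> C) = 2 * m" "sum f (A \<union> C) = sum f A + sum f C"
    using fin disj card by (simp_all add: card_Un_disjoint sum.union_disjoint)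
  define w a sA sB sC qA qB qC where "w = f 0" and "a = f 1"
    and "sA = sum f A" and "sB = sum f B" and "sC = sum f C"
    and "qA = (\<Sum>v\<in>A. (f v)\<^sup>2)" and "qB = (\<Sum>v\<in>B. (f v)\<^sup>2)" and "qC = (\<Sum>v\<in>C. (f v)\<^sup>2)"
  note defs = w_def a_def sA_def sB_def sC_def qA_def qB_def qC_def
  have "(\<Sum>v\<in>pverts ?G. real (card (nbrs ?G v)) * (f v)\<^sup>2)
      = (m + 1) * w\<^sup>2 + (m + 1) * a\<^sup>2 + (m + 1) * qA + 2 * m * qB + (m + 1) * qC"
    by (subst split) (simp add: nbrs fin disj card AC defs sum_distrib_left add.commute[of "1::real"] del: One_nat_def cong: sum.cong)
  moreover have "(\<Sum>v\<in>pverts ?G. \<Sum>u\<in>nbrs ?G v. f u * f v)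
      = (a + sC) * w + (w + sA) * a + (a + sB) * sA + (sA + sC) * sB + (w + sB) * sC"
    unfolding sum_distrib_right[symmetric]
    by (subst split) (simp add: nbrs fin disj AC defs sum_distrib_left del: One_nat_def cong: sum.cong)
  ultimately have form: "laplacian_form ?G f
      = (m + 1) * w\<^sup>2 + (m + 1) * a\<^sup>2 + (m + 1) * qA + 2 * m * qB + (m + 1) * qC
        - (2 * w * a + 2 * w * sC + 2 * a * sA + 2 * sB * (sA + sC))"
    unfolding laplacian_form_def by (simp add: algebra_simps)
  have q: "qA \<ge> 0" "qB \<ge> 0" "qC \<ge> 0" by (auto simp: defs intro: sum_nonneg)
  have "2 * w * sC \<le> \<epsilon> * m * w\<^sup>2 + qC / \<epsilon>" "2 * a * sA \<le> \<epsilon> * m * a\<^sup>2 + qA / \<epsilon>"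
    using two_mult_sum_le[OF \<epsilon>, of w f C] two_mult_sum_le[OF \<epsilon>, of a f A]
    by (simp_all add: card defs)
  moreover have "2 * w * a \<le> w\<^sup>2 + a\<^sup>2" using sum_squares_bound[of w a] by simp
  moreover have "2 * sB * (sA + sC) \<le> m * qB + 2 / 3 * (w\<^sup>2 + a\<^sup>2)"
  proof -
    \<comment> \<open>Cauchy-Schwarz, obtained by taking the mean of \<open>f\<close> over
      \<open>B\<close> for \<open>w\<close>.\<close>
    have "sB\<^sup>2 \<le> m * qB"
      using two_mult_sum_le[of 1 "sB / m" f B] m
      by (simp add: card sB_def qB_def power2_eq_square field_simps)
    moreover have sAC: "sA + sC = - (w + a) - sB"
      using f0 unfolding split by (simp add: defs)
    \<comment> \<open>Completing the square in \<open>sB\<close> after \<open>sA + sC\<close> has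
      been eliminated.\<close>
    have "2 * sB * (sA + sC) = sB\<^sup>2 + (w + a)\<^sup>2 / 3 - (3 * sB + (w + a))\<^sup>2 / 3"
      unfolding sAC by (simp add: power2_eq_square field_simps)
    moreover have "(w + a)\<^sup>2 \<le> 2 * (w\<^sup>2 + a\<^sup>2)"
      using sum_squares_bound[of w a] by (simp add: power2_sum)
    moreover have "0 \<le> (3 * sB + (w + a))\<^sup>2" by simp
    ultimately show ?thesis by argo
  qed
  ultimately have lower: "laplacian_form ?G f \<ge> (m - \<epsilon> * m - 2 / 3) * (w\<^sup>2 + a\<^sup>2)
      + (m + 1 - 1 / \<epsilon>) * (qA + qC) + m * qB"
    unfolding form by (simp add: algebra_simps add_divide_distrib)
  let ?c = "m - \<epsilon> * m - 1 / \<epsilon> - 1"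
  have "?c * (\<Sum>v\<in>pverts ?G. (f v)\<^sup>2) = ?c * (w\<^sup>2 + a\<^sup>2) + ?c * (qA + qC) + ?c * qB"
    unfolding split by (simp add: defs algebra_simps)
  also have "\<dots> \<le> (m - \<epsilon> * m - 2 / 3) * (w\<^sup>2 + a\<^sup>2) + (m + 1 - 1 / \<epsilon>) * (qA + qC) + m * qB"
  proof -
    have "0 \<le> 1 / \<epsilon>" "0 \<le> \<epsilon> * m" "0 \<le> w\<^sup>2 + a\<^sup>2" using \<epsilon> by simp_all
    then show ?thesis using q by (intro add_mono mult_right_mono) linarith+
  qed
  also note lower
  finally show "?c * (\<Sum>v\<in>pverts ?G. (f v)\<^sup>2) \<le> laplacian_form ?G f" .
qed

theorem theorem1p3:
  shows "(\<forall>G :: 'a pair_pre_digraph.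
            pair_graph G \<and> card (pverts G) \<ge> 2 \<and> triangle_free G \<and>
            \<mu>\<^bsub>2\<^esub> G \<ge> real (card (pverts G)) / 3
            \<longrightarrow> bipartite G)
       \<and> (\<forall>\<epsilon>::real. \<epsilon> > 0 \<longrightarrow>
            (\<forall>N::nat. \<exists>G :: nat pair_pre_digraph.
               pair_graph G \<and> card (pverts G) \<ge> 2 \<and> card (pverts G) \<ge> N \<and>
               \<not> bipartite G \<and> triangle_free G \<and>
               \<mu>\<^bsub>2\<^esub> G > (1 / 3 - \<epsilon>) * real (card (pverts G))))"
proof (intro conjI allI impI)
  fix G :: "'a pair_pre_digraph"
  assume "pair_graph G \<and> card (pverts G) \<ge> 2 \<and> triangle_free G \<and>
    \<mu>\<^bsub>2\<^esub> G \<ge> real (card (pverts G)) / 3"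
  then show "bipartite G" using bipartite_if_algebraic_connectivity_ge by blast
next
  fix \<epsilon> :: real and N :: nat
  assume \<epsilon>: "\<epsilon> > 0"
  \<comment> \<open>Large enough for \<open>\<epsilon> * m \<ge> 1 / \<epsilon> + 2\<close>. The
    same \<open>\<epsilon>\<close> is the Young parameter: the bound loses
    \<open>\<epsilon> * m + 1 / \<epsilon> + 1\<close>, while the target leaves room for about
    \<open>3 * \<epsilon> * m\<close>.\<close>
  define m where "m = max (max 1 N) (nat \<lceil>(1 / \<epsilon> + 2) / \<epsilon>\<rceil>)"
  have m: "m \<ge> 1" "m \<ge> N" by (auto simp: m_def)
  have "(1 / \<epsilon> + 2) / \<epsilon> \<le> real (nat \<lceil>(1 / \<epsilon> + 2) / \<epsilon>\<rceil>)" by (rule real_nat_ceiling_ge)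
  also have "\<dots> \<le> m" by (simp add: m_def)
  finally have "1 / \<epsilon> + 2 \<le> \<epsilon> * m" using \<epsilon> by (simp add: pos_divide_le_eq mult.commute)
  moreover have "0 \<le> \<epsilon> * m" using \<epsilon> by simp
  moreover have "(1 / 3 - \<epsilon>) * real (3 * m + 2) = m + 2 / 3 - 3 * (\<epsilon> * m) - 2 * \<epsilon>"
    by (simp add: algebra_simps)
  ultimately have "(1 / 3 - \<epsilon>) * real (3 * m + 2) < m - \<epsilon> * m - 1 / \<epsilon> - 1"
    using \<epsilon> by linarith
  also have "\<dots> \<le> \<mu>\<^bsub>2\<^esub> (pentagon_blowup m)"
    by (rule algebraic_connectivity_pentagon_blowup[OF m(1) \<epsilon>])
  finally have "(1 / 3 - \<epsilon>) * real (3 * m + 2) < \<mu>\<^bsub>2\<^esub> (pentagon_blowup m)" .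
  moreover have "card (pverts (pentagon_blowup m)) = 3 * m + 2" by (simp add: pentagon_blowup_def)
  ultimately show "\<exists>G :: nat pair_pre_digraph.
      pair_graph G \<and> card (pverts G) \<ge> 2 \<and> card (pverts G) \<ge> N \<and> \<not> bipartite G \<and> triangle_free G \<and>
      \<mu>\<^bsub>2\<^esub> G > (1 / 3 - \<epsilon>) * real (card (pverts G))"
    using m pair_graph_pentagon_blowup triangle_free_pentagon_blowup not_bipartite_pentagon_blowup
    by (intro exI[of _ "pentagon_blowup m"]) auto
qed

end
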